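(* Let $\lambda=(\lambda_1\ge\dots\ge\lambda_n>0)$ be a partition of length $n$ with $\lambda_1\le N$, and let $\sigma,w\in S_n$ be such that $\sigma$ is the maximal length representative of its coset $[\sigma]\in S_n/\mathrm{Stab}(w_0\cdot\lambda)$. Then $$Z^{\lambda}_{\sigma,w}(\boldsymbol{x};\boldsymbol{y})=t^{\ell(\sigma)}\,\tau_w^{-1}\,\tau_{\sigma w_0}\cdot\left[\prod_{i=1}^n\prod_{j<\lambda_i}\left(1-\frac{x_i}{y_j}\right)\right].$$
   Context: $\ell$ is the Coxeter length on $S_n$, $s_i=(i,i+1)$, $w_0(i)=n+1-i$, products of permutations are compositions, $w_0\cdot\lambda=(\lambda_n,\dots,\lambda_1)$, and $\mathrm{Stab}(w_0\cdot\lambda)$ is its stabilizer in $S_n$ under permutation of positions; cosets are left cosets $\sigma\,\mathrm{Stab}(w_0\cdot\lambda)$. In $\prod_{j<\lambda_i}$, $j$ runs over $1\le j<\lambda_i$. Write $\boldsymbol{x}^{\alpha_i}=x_i/x_{i+1}$, and let $s_i$ act on functions of $(\boldsymbol{x};\boldsymbol{y})$ by exchanging $x_i$ and $x_{i+1}$, fixing all $y_j$. Put $$\tau_i f=\frac{t-1}{1-\boldsymbol{x}^{\alpha_i}}f+\frac{\boldsymbol{x}^{\alpha_i}-t}{1-\boldsymbol{x}^{\alpha_i}}\,s_if .$$ These operators are invertible and satisfy the braid relations, so $\tau_w:=\tau_{i_1}\cdots\tau_{i_\ell}$ is well defined for any reduced word $w=s_{i_1}\cdots s_{i_\ell}$.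 Lattice model: a rectangular grid with $n$ rows numbered $1,\dots,n$ from top to bottom and $N\ge n$ columns numbered $1,\dots,N$ from right to left; $t$ is an indeterminate, and the vertex in row $i$, column $j$ has parameters $x=x_i$, $y=y_j$. Horizontal edges carry a spin in $\{+,1,\dots,n\}$ ($+$ = uncolored), vertical edges carry a subset of the color set $\{1<\dots<n\}$. The weight of a vertex with left spin $L$, top spin $\Sigma$, right spin $L'$, bottom spin $\Sigma'$, written $(L,\Sigma;L',\Sigma')$, is zero unless listed ($\Sigma_{>c},\Sigma_{<c},\Sigma_{(c,d)}$ denote the elements of $\Sigma$ that are $>c$, $<c$, strictly between $c$ and $d$): (1) $(+,\Sigma;+,\Sigma)$: $(-t)^{|\Sigma|}$. (2) $(c,\Sigma;c,\Sigma)$: $t^{|\Sigma_{>c}|}(-xy^{-1}+t^{\delta})$ with $\delta=1$ if $c\in\Sigma$, else $0$. (3) $(+,\Sigma;c,\Sigma\setminus\{c\})$, $c\in\Sigma$: $(-t)^{|\Sigma_{<c}|}t^{|\Sigma_{>c}|}$. (4) $(c,\Sigma;+,\Sigma\cup\{c\})$, $c\notin\Sigma$: $-(1-t)xy^{-1}(-t)^{|\Sigma_{>c}|}$. (5) $(c,\Sigma;d,(\Sigma\cup\{c\})\setminus\{d\})$, $c<d$, $d\in\Sigma$, $c\notin\Sigma$: $-(1-t)xy^{-1}(-t)^{|\Sigma_{(c,d)}|}t^{|\Sigma_{>d}|}$. (6) $(d,\Sigma;c,(\Sigma\cup\{d\})\setminus\{c\})$, $c<d$, $c\in\Sigma$,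 $d\notin\Sigma$: $-(1-t)(-1)^{|\Sigma_{(c,d)}|}t^{|\Sigma_{>d}|}$. $Z^\lambda_{\sigma,w}(\boldsymbol{x};\boldsymbol{y})$ is the partition function, i.e. the sum over all assignments of spins to interior edges of the product of the vertex weights, with boundary conditions: for each $i$ the top boundary edge in column $\lambda_i$ carries the color $\sigma(n+1-i)$ (a column may carry several colors), other top edges are empty; the right boundary edge in row $i$ has color $w(i)$; left and bottom boundary edges are uncolored. *)

theory Defs
  imports
    "HOL-Library.Poly_Mapping"
    "HOL-Library.FuncSet"
    "HOL-Combinatorics.Permutations"
    "HOL-Computational_Algebra.Fraction_Field"
begin

section \<open>Rational functions in t, x, y\<close>

datatype var = T | X nat | Y nat

text \<open>
  The order on variables is a technical device: the library derives the integral domain structure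
  of polynomial rings (and hence the fraction field) from a linear order on the variables.
\<close>

fun var_code :: "var \<Rightarrow> nat" where
  "var_code T = 0"
| "var_code (X i) = 2 * i + 1"
| "var_code (Y j) = 2 * j + 2"

lemma var_code_inject: "var_code u = var_code v \<longleftrightarrow> u = v"
  by (cases u; cases v) (auto, presburger+)

instantiation var :: linorder
begin

definition less_eq_var :: "var \<Rightarrow> var \<Rightarrow> bool" where
  "u \<le> v \<longleftrightarrow> var_code u \<le> var_code v"

definition less_var :: "var \<Rightarrow> var \<Rightarrow> bool" where
  "u < v \<longleftrightarrow> var_code u < var_code v"

instance
  by standard (auto simp: less_eq_var_def less_var_def var_code_inject[symmetric])

end

type_synonym monomial = "var \<Rightarrow>\<^sub>0 nat"
type_synonym 'k mvpoly = "monomial \<Rightarrow>\<^sub>0 'k"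
type_synonym 'k ratfun = "'k mvpoly fract"

definition rvar :: "var \<Rightarrow> 'k::field ratfun" where
  "rvar v = Fract (Poly_Mapping.single (Poly_Mapping.single v 1) 1) 1"

abbreviation tv :: "'k::field ratfun" where "tv \<equiv> rvar T"
abbreviation xv :: "nat \<Rightarrow> 'k::field ratfun" where "xv i \<equiv> rvar (X i)"
abbreviation yv :: "nat \<Rightarrow> 'k::field ratfun" where "yv j \<equiv> rvar (Y j)"


section \<open>The action of simple transpositions on rational functions\<close>

fun swap_var :: "nat \<Rightarrow> var \<Rightarrow> var" where
  "swap_var i T = T"
| "swap_var i (X k) = X (Transposition.transpose i (Suc i) k)"
| "swap_var i (Y j) = Y j"

lemma swap_var_swap_var [simp]: "swap_var i (swap_var i v) = v"
  by (cases v) simp_all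

lemma inj_swap_var: "inj (swap_var i)"
  by (metis injI swap_var_swap_var)

text \<open>
  As \<open>map_key\<close> is precomposition and \<open>swap_var i\<close> is an involution, \<open>swap_mono i\<close> replaces
  each variable \<open>v\<close> of a monomial by \<open>swap_var i v\<close>; likewise for \<open>swap_poly\<close>.
\<close>

definition swap_mono :: "nat \<Rightarrow> monomial \<Rightarrow> monomial" where
  "swap_mono i = Poly_Mapping.map_key (swap_var i)"

lemma swap_mono_swap_mono [simp]: "swap_mono i (swap_mono i m) = m"
proof -
  have "swap_var i \<circ> swap_var i = (\<lambda>v. v)" by (rule ext) simp
  thus ?thesis
    by (simp add: swap_mono_def map_key_compose[OF inj_swap_var inj_swap_var] map_key_id)
qed

lemma inj_swap_mono: "inj (swap_mono i)"
  by (metis injI swap_mono_swap_mono)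

lemma swap_mono_add: "swap_mono i (m + m') = swap_mono i m + swap_mono i m'"
  by (simp add: swap_mono_def map_key_plus[OF inj_swap_var])

lemma swap_mono_single: "swap_mono i (Poly_Mapping.single v e) = Poly_Mapping.single (swap_var i v) e"
  using map_key_single[OF inj_swap_var, of i "swap_var i v" e] by (simp add: swap_mono_def)

definition swap_poly :: "nat \<Rightarrow> 'k::field mvpoly \<Rightarrow> 'k mvpoly" where
  "swap_poly i = Poly_Mapping.map_key (swap_mono i)"

lemma swap_poly_swap_poly [simp]: "swap_poly i (swap_poly i p) = p"
proof -
  have "swap_mono i \<circ> swap_mono i = (\<lambda>m. m)" by (rule ext) simp
  thus ?thesis
    by (simp add: swap_poly_def map_key_compose[OF inj_swap_mono inj_swap_mono] map_key_id)
qed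

lemma swap_poly_zero [simp]: "swap_poly i 0 = 0"
  by (simp add: swap_poly_def map_key_zero[OF inj_swap_mono])

lemma swap_poly_eq_0_iff [simp]: "swap_poly i p = 0 \<longleftrightarrow> p = 0"
  by (metis swap_poly_swap_poly swap_poly_zero)

lemma swap_poly_add: "swap_poly i (p + q) = swap_poly i p + swap_poly i q"
  by (simp add: swap_poly_def map_key_plus[OF inj_swap_mono])

lemma swap_poly_single: "swap_poly i (Poly_Mapping.single m c) = Poly_Mapping.single (swap_mono i m) c"
  using map_key_single[OF inj_swap_mono, of i "swap_mono i m" c] by (simp add: swap_poly_def)

lemma mvpoly_induct [case_names single add]:
  fixes p :: "'k::field mvpoly"
  assumes single: "\<And>m c. P (Poly_Mapping.single m c)"
    and add: "\<And>p q. P p \<Longrightarrow> P q \<Longrightarrow> P (p + q)"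
  shows "P p"
proof (induction p rule: update_induct)
  case const
  show ?case using single[of 0 0] by simp
next
  case (update p m c)
  have "Poly_Mapping.update m c p = Poly_Mapping.single m c + p"
    using update(1)
    by (intro poly_mapping_eqI) (auto simp: lookup_update lookup_add lookup_single in_keys_iff)
  thus ?case using add[OF single update(3)] by simp
qed

lemma swap_poly_mult: "swap_poly i (p * q) = swap_poly i p * swap_poly i q"
proof (induction p rule: mvpoly_induct)
  case (single m c)
  show ?case
    by (induction q rule: mvpoly_induct)
      (simp_all add: mult_single swap_poly_single swap_mono_add swap_poly_add distrib_left)
next
  case (add p p')
  thus ?case by (simp add: swap_poly_add distrib_right)
qed

lift_definition s_act :: "nat \<Rightarrow> 'k::field ratfun \<Rightarrow> 'k ratfun" is
  "\<lambda>i (p, q). (swap_poly i p, swap_poly i q)"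
  by (auto simp: swap_poly_mult[symmetric])

lemma s_act_Fract: "q \<noteq> 0 \<Longrightarrow> s_act i (Fract p q) = Fract (swap_poly i p) (swap_poly i q)"
  by transfer simp

lemma s_act_rvar: "s_act i (rvar v :: 'k::field ratfun) = rvar (swap_var i v)"
proof -
  have "swap_poly i (1 :: 'k mvpoly) = 1"
    using swap_poly_single[of i 0 "1::'k"]
    by (simp add: swap_mono_def map_key_zero[OF inj_swap_var])
  thus ?thesis
    by (simp add: rvar_def s_act_Fract swap_poly_single swap_mono_single)
qed

lemma s_act_add: "s_act i (f + g) = s_act i f + s_act i g"
  by (cases f; cases g) (simp add: s_act_Fract swap_poly_add swap_poly_mult)

lemma s_act_mult: "s_act i (f * g) = s_act i f * s_act i g"
  by (cases f; cases g) (simp add: s_act_Fract swap_poly_mult)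


section \<open>Symmetric group\<close>

definition s_prod :: "nat list \<Rightarrow> nat \<Rightarrow> nat" where
  "s_prod is = foldr (\<lambda>i p. Transposition.transpose i (Suc i) \<circ> p) is id"

definition word_for :: "nat \<Rightarrow> (nat \<Rightarrow> nat) \<Rightarrow> nat list \<Rightarrow> bool" where
  "word_for n w is \<longleftrightarrow> set is \<subseteq> {1..<n} \<and> s_prod is = w"

definition coxeter_length :: "nat \<Rightarrow> (nat \<Rightarrow> nat) \<Rightarrow> nat" where
  "coxeter_length n w = (LEAST l. \<exists>is. word_for n w is \<and> length is = l)"

definition reduced_word :: "nat \<Rightarrow> (nat \<Rightarrow> nat) \<Rightarrow> nat list \<Rightarrow> bool" where
  "reduced_word n w is \<longleftrightarrow> word_for n w is \<and> length is = coxeter_length n w"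

text \<open>Elements of the symmetric group are the functions \<open>w\<close> with \<open>w permutes {1..n}\<close>; they fix
  everything outside \<open>{1..n}\<close>.\<close>

definition w0 :: "nat \<Rightarrow> nat \<Rightarrow> nat" where
  "w0 n i = (if i \<in> {1..n} then n + 1 - i else i)"

definition perm_act :: "(nat \<Rightarrow> nat) \<Rightarrow> (nat \<Rightarrow> nat) \<Rightarrow> nat \<Rightarrow> nat" where
  "perm_act p \<mu> = \<mu> \<circ> inv p"

definition stab :: "nat \<Rightarrow> (nat \<Rightarrow> nat) \<Rightarrow> (nat \<Rightarrow> nat) set" where
  "stab n \<mu> = {p. p permutes {1..n} \<and> (\<forall>k\<in>{1..n}. perm_act p \<mu> k = \<mu> k)}"

definition left_coset :: "nat \<Rightarrow> (nat \<Rightarrow> nat) \<Rightarrow> (nat \<Rightarrow> nat) \<Rightarrow> (nat \<Rightarrow> nat) set" where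
  "left_coset n \<mu> \<sigma> = (\<lambda>p. \<sigma> \<circ> p) ` stab n \<mu>"

definition max_length_rep :: "nat \<Rightarrow> (nat \<Rightarrow> nat) \<Rightarrow> (nat \<Rightarrow> nat) \<Rightarrow> bool" where
  "max_length_rep n \<mu> \<sigma> \<longleftrightarrow>
     (\<forall>\<rho>\<in>left_coset n \<mu> \<sigma>. coxeter_length n \<rho> \<le> coxeter_length n \<sigma>)"


section \<open>The operators\<close>

definition xalpha :: "nat \<Rightarrow> 'k::field ratfun" where
  "xalpha i = xv i / xv (i + 1)"

definition tau_gen :: "nat \<Rightarrow> 'k::field ratfun \<Rightarrow> 'k ratfun" where
  "tau_gen i f =
     (tv - 1) / (1 - xalpha i) * f + (xalpha i - tv) / (1 - xalpha i) * s_act i f"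

definition tau_word :: "nat list \<Rightarrow> 'k::field ratfun \<Rightarrow> 'k ratfun" where
  "tau_word is = foldr (\<lambda>i F. tau_gen i \<circ> F) is id"

text \<open>The choice of the reduced word is immaterial, by the braid relations.\<close>

definition tau :: "nat \<Rightarrow> (nat \<Rightarrow> nat) \<Rightarrow> 'k::field ratfun \<Rightarrow> 'k ratfun" where
  "tau n w = tau_word (SOME is. reduced_word n w is)"


section \<open>The lattice model\<close>

text \<open>
  Horizontal spins: \<open>None\<close> is uncolored, \<open>Some c\<close> is the color \<open>c\<close>.
  Arguments after \<open>x\<close> and \<open>y\<close>: left, top, right, bottom spin.
\<close>

definition vertex_weight ::
  "'k::field ratfun \<Rightarrow> 'k ratfun \<Rightarrow> nat option \<Rightarrow> nat set \<Rightarrow> nat option \<Rightarrow> nat set \<Rightarrow> 'k ratfun" where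
  "vertex_weight x y L S R B =
     (case (L, R) of
        (None, None) \<Rightarrow>
          if B = S then (- tv) ^ card S else 0
      | (None, Some c) \<Rightarrow>
          if c \<in> S \<and> B = S - {c}
          then (- tv) ^ card {e\<in>S. e < c} * tv ^ card {e\<in>S. c < e} else 0
      | (Some c, None) \<Rightarrow>
          if c \<notin> S \<and> B = S \<union> {c}
          then - (1 - tv) * (x / y) * (- tv) ^ card {e\<in>S. c < e} else 0
      | (Some c, Some d) \<Rightarrow>
          if c = d then
            if B = S
            then tv ^ card {e\<in>S. c < e} * (- (x / y) + tv ^ (if c \<in> S then 1 else 0)) else 0
          else if d \<in> S \<and> c \<notin> S \<and> B = (S \<union> {c}) - {d} then
            if c < d
            then - (1 - tv) * (x / y) * (- tv) ^ card {e\<in>S. c < e \<and> e < d} * tv ^ card {e\<in>S. d < e}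
            else - (1 - tv) * (- 1) ^ card {e\<in>S. d < e \<and> e < c} * tv ^ card {e\<in>S. c < e}
          else 0)"

text \<open>
  Rows are numbered from top to bottom and columns from right to left. The vertex in row \<open>i\<close> and
  column \<open>j\<close> has right edge \<open>h (i, j - 1)\<close>, left edge \<open>h (i, j)\<close>, top edge \<open>v (i - 1, j)\<close> and
  bottom edge \<open>v (i, j)\<close>. So the right and left boundary edges of row \<open>i\<close> are \<open>h (i, 0)\<close> and
  \<open>h (i, N)\<close>, and the top and bottom boundary edges of column \<open>j\<close> are \<open>v (0, j)\<close> and \<open>v (n, j)\<close>.
\<close>

definition top_boundary :: "nat \<Rightarrow> (nat \<Rightarrow> nat) \<Rightarrow> (nat \<Rightarrow> nat) \<Rightarrow> nat \<Rightarrow> nat set" where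
  "top_boundary n lam \<sigma> j = {\<sigma> (n + 1 - i) | i. i \<in> {1..n} \<and> lam i = j}"

definition states ::
  "nat \<Rightarrow> nat \<Rightarrow> (nat \<Rightarrow> nat) \<Rightarrow> (nat \<Rightarrow> nat) \<Rightarrow> (nat \<Rightarrow> nat) \<Rightarrow>
     ((nat \<times> nat \<Rightarrow> nat option) \<times> (nat \<times> nat \<Rightarrow> nat set)) set" where
  "states n N lam \<sigma> w =
     {(h, v).
        h \<in> ({1..n} \<times> {0..N}) \<rightarrow>\<^sub>E insert None (Some ` {1..n}) \<and>
        v \<in> ({0..n} \<times> {1..N}) \<rightarrow>\<^sub>E Pow {1..n} \<and>
        (\<forall>i\<in>{1..n}. h (i, 0) = Some (w i) \<and> h (i, N) = None) \<and>
        (\<forall>j\<in>{1..N}. v (0, j) = top_boundary n lam \<sigma> j \<and> v (n, j) = {})}"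

definition partition_function ::
  "nat \<Rightarrow> nat \<Rightarrow> (nat \<Rightarrow> nat) \<Rightarrow> (nat \<Rightarrow> nat) \<Rightarrow> (nat \<Rightarrow> nat) \<Rightarrow> 'k::field ratfun" where
  "partition_function n N lam \<sigma> w =
     (\<Sum>(h, v)\<in>states n N lam \<sigma> w. \<Prod>i\<in>{1..n}. \<Prod>j\<in>{1..N}.
        vertex_weight (xv i) (yv j) (h (i, j)) (v (i - 1, j)) (h (i, j - 1)) (v (i, j)))"

end

theory Submission
  imports Defs
begin

text \<open>
  Write \<open>Z\<^sub>w\<close> for the partition function with right boundary \<open>w\<close>, all other data being fixed. The theorem
  has two ingredients.

  \<^item> If \<open>w i < w (i + 1)\<close>, then \<open>Z\<^sub>w = \<tau>\<^sub>i Z\<^bsub>w s\<^sub>i\<^esub>\<close> (\<open>rows_weight_exchange\<close>). Reading a reduced word of \<open>w\<close> from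
    its right end, this gives \<open>\<tau>\<^sub>w Z\<^sub>w = Z\<^sub>1\<close> for every \<open>w\<close> (\<open>tau_rows_weight\<close>), so \<open>\<tau>\<^sub>w Z\<^sub>w\<close> is one and
    the same function for all \<open>w\<close>.
  \<^item> For \<open>w = \<sigma> w\<^sub>0\<close> the lattice has a single state, because the color leaving row \<open>i\<close> is the one
    that enters at the top of column \<open>\<lambda>\<^sub>i\<close>: it comes straight down to row \<open>i\<close> and turns right there
    (\<open>rows_weight_block_ascending\<close>). Maximality of \<open>\<sigma>\<close> in its coset makes the color leaving row \<open>i\<close>
    the least of those waiting in column \<open>\<lambda>\<^sub>i\<close>, so no power of \<open>-t\<close> survives, and the powers
    of \<open>t\<close> count the inversions of \<open>\<sigma>\<close>. Hence
    \<open>Z\<^bsub>\<sigma> w\<^sub>0\<^esub> = t\<^bsup>\<ell>(\<sigma>)\<^esup> \<Prod>\<^sub>i \<Prod>\<^bsub>j < \<lambda>\<^sub>i\<^esub> (1 - x\<^sub>i / y\<^sub>j)\<close>.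

  Comparing \<open>\<tau>\<^sub>w Z\<^sub>w\<close> with \<open>\<tau>\<^bsub>\<sigma> w\<^sub>0\<^esub> Z\<^bsub>\<sigma> w\<^sub>0\<^esub>\<close> and inverting the injective operator \<open>\<tau>\<^sub>w\<close> gives the claim.

  The first ingredient is a Yang-Baxter argument. Two adjacent rows are crossed on the left, where both
  spins are uncolored, and the crossing is moved through the columns one at a time
  (\<open>vertex_yang_baxter\<close>, \<open>row_pair_yang_baxter\<close>); when it comes out on the right, the weights of the
  crossing are the coefficients of \<open>\<tau>\<^sub>i\<close>. The Yang-Baxter equation of a single column involves an
  arbitrary set of colors on the vertical edge, but the colors on it that differ from
  the four horizontal spins only contribute a common factor: the contribution of such a color
  to a vertex is a product of a function of the left spin and a function of the right spin
  (\<open>vertex_weight_eq\<close>). What remains is an identity in the four horizontal spins, checked for each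
  of their relative orders (\<open>core_weight_yang_baxter\<close>).
\<close>

section \<open>The Yang-Baxter equation for the spins that take part in a crossing\<close>


text \<open>
  Spins are numbered by levels: \<open>0\<close> for the uncolored spin and \<open>c + 1\<close> for the color \<open>c\<close>, so that the
  uncolored spin is the least one. The weights below are the vertex weights with \<open>z = x / y\<close>,
  multiplied by \<open>t\<close> to avoid denominators, from which the powers of \<open>-1\<close> and \<open>t\<close> that count
  colors of the top edge (the horizontal spins among them) have been removed; \<open>m\<close> tells whether the left spin
  occurs on the top edge.
\<close>
definition local_weight :: "'a::field \<Rightarrow> 'a \<Rightarrow> nat \<Rightarrow> nat \<Rightarrow> bool \<Rightarrow> 'a" where
  "local_weight t z L R m =
     (if L = R then if L = 0 then t else t * ((if m then t else 1) - z)
      else if L = 0 then - 1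
      else if R = 0 then - t * (1 - t) * z
      else if L < R then (1 - t) * z
      else - t * (1 - t))"

text \<open>
  A color at level \<open>e\<close> on the top edge contributes \<open>left_factor t L e * right_factor R e\<close> to the weight
  of a vertex with left spin \<open>L\<close> and right spin \<open>R\<close>.
\<close>
definition left_factor :: "'a::field \<Rightarrow> nat \<Rightarrow> nat \<Rightarrow> 'a" where
  "left_factor t L e = (if L < e then - t else 1)"

definition right_factor :: "nat \<Rightarrow> nat \<Rightarrow> 'a::field" where
  "right_factor R e = (if 0 < R \<and> R < e then - 1 else 1)"

text \<open>
  The condition for a bottom edge to exist: adding \<open>L\<close> to a top edge described by \<open>m\<close> and removing
  \<open>R\<close> must give a set without repeated colors.
\<close>
definition passable :: "(nat \<Rightarrow> bool) \<Rightarrow> nat \<Rightarrow> nat \<Rightarrow> bool" where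
  "passable m L R \<longleftrightarrow> L = R \<or> \<not> m L \<and> (R = 0 \<or> m R)"

text \<open>
  This is \<open>t ^ 3\<close> times the weight of two vertices in a column, with left spins \<open>a\<close>, \<open>b\<close> and right spins
  \<open>c\<close>, \<open>d\<close> (upper vertex first), divided by the \<open>left_factor\<close>s and \<open>right_factor\<close>s of all colors on the top edge.
  These factors are symmetric in \<open>a\<close>, \<open>b\<close> and in \<open>c\<close>, \<open>d\<close>, but for the lower vertex they have to be
  taken over the middle edge, which has gained \<open>a\<close> and lost \<open>c\<close>; this accounts for the factors indexed by
  \<open>a\<close> and \<open>c\<close> in the definition. The second factor is \<open>t\<close> divided by \<open>left_factor t b c\<close>. The
  condition in the last line says that \<open>b\<close> occurs on the middle edge.
\<close>
definition core_weight :: "'a::field \<Rightarrow> 'a \<Rightarrow> 'a \<Rightarrow> (nat \<Rightarrow> bool) \<Rightarrow> nat \<Rightarrow> nat \<Rightarrow> nat \<Rightarrow> nat \<Rightarrow> 'a" where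
  "core_weight t z z' m a b c d =
     (if passable m a c then
        left_factor t b a * (if b < c then - 1 else t) * right_factor d a * right_factor d c *
        local_weight t z a c (m a) *
        local_weight t z' b d (if a = c then m b else b = a \<or> b \<noteq> c \<and> m b)
      else 0)"

text \<open>
  A crossing of two rows with parameters \<open>z\<close> and \<open>z'\<close> keeps the upper spin \<open>a\<close> and the lower spin \<open>b\<close> at
  their heights with weight \<open>R_diag t z z' a b\<close> and exchanges them with weight \<open>R_swap t z z' a b\<close>.
  For \<open>a \<noteq> b\<close> both weights depend only on the order of \<open>a\<close> and \<open>b\<close>; in \<open>R_diag\<close> the uncolored spin counts as
  larger than all colors, in \<open>R_swap\<close> as smaller.
\<close>
definition R_diag :: "'a::field \<Rightarrow> 'a \<Rightarrow> 'a \<Rightarrow> nat \<Rightarrow> nat \<Rightarrow> 'a" where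
  "R_diag t z z' a b =
     (if a = b then if a = 0 then z' - t * z else z - t * z'
      else if a = 0 \<or> 0 < b \<and> b < a then (1 - t) * z
      else (1 - t) * z')"

definition R_swap :: "'a::field \<Rightarrow> 'a \<Rightarrow> 'a \<Rightarrow> nat \<Rightarrow> nat \<Rightarrow> 'a" where
  "R_swap t z z' a b = (if a = b then 0 else if a < b then z - z' else t * (z - z'))"

text \<open>
  Conservation of colors forces most terms to vanish: it determines which of the four spins occur
  on the top edge, up to spins that occur on both sides. In each of the resulting cases, and
  for each relative order of the distinct spins, the claim is a polynomial identity in \<open>t\<close>, \<open>z\<close>, \<open>z'\<close>.
\<close>
lemma core_weight_yang_baxter:
  fixes t z z' :: "'a::field"
  assumes t: "t \<noteq> 0"
    and zero: "\<not> m 0"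
    and cons: "\<And>e. 0 < e \<Longrightarrow> of_bool (m e) + of_bool (a = e) + of_bool (b = e) =
       (of_bool (m' e) + of_bool (c = e) + of_bool (d = e) :: nat)"
  shows "R_diag t z z' a b * core_weight t z z' m a b c d + R_swap t z z' a b * core_weight t z z' m b a c d =
         R_diag t z z' c d * core_weight t z' z m a b c d + R_swap t z z' d c * core_weight t z' z m a b d c"
    (is ?yb)
proof -
  note defs = core_weight_def R_diag_def R_swap_def passable_def local_weight_def left_factor_def right_factor_def
  note [simp] = t zero
  have from_left: "0 < x \<longrightarrow> (x = y \<longrightarrow> c = x \<or> d = x) \<and>
      ((x = y) = (c = x \<or> d = x) \<and> \<not> (c = x \<and> d = x) \<longrightarrow> \<not> m x)"
    if "(x, y) = (a, b) \<or> (x, y) = (b, a)" for x y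
    using cons[of x] that by (auto simp: of_bool_def split: if_splits)
  have from_right: "0 < x \<longrightarrow> (x = y \<longrightarrow> a = x \<or> b = x) \<and>
      ((x = y) = (a = x \<or> b = x) \<and> \<not> (a = x \<and> b = x) \<longrightarrow> m x)"
    if "(x, y) = (c, d) \<or> (x, y) = (d, c)" for x y
    using cons[of x] that by (auto simp: of_bool_def split: if_splits)
  have compare: "P" if "x \<noteq> y" "x < y \<Longrightarrow> P" "y < x \<Longrightarrow> P" for x y :: nat and P
    using that by (meson nat_neq_iff)
  \<comment> \<open>Level \<open>0\<close> may occur twice on one side, since the uncolored spin is not conserved on its own; this
    gives the two cases with \<open>a = b = 0\<close> or \<open>c = d = 0\<close>.\<close>
  consider
      "a = b" "c = a" "d = a"
    | "a = b" "c = a" "d \<noteq> a" "\<not> m a" "d = 0 \<or> m d"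
    | "a = b" "c \<noteq> a" "d = a" "\<not> m a" "c = 0 \<or> m c"
    | "a \<noteq> b" "c = a" "d = a" "a = 0 \<or> m a" "\<not> m b"
    | "a \<noteq> b" "c = b" "d = b" "b = 0 \<or> m b" "\<not> m a"
    | "a \<noteq> b" "c = a" "d = b"
    | "a \<noteq> b" "c = b" "d = a"
    | "a \<noteq> b" "c = a" "d \<noteq> a" "d \<noteq> b" "\<not> m b" "d = 0 \<or> m d"
    | "a \<noteq> b" "c = b" "d \<noteq> a" "d \<noteq> b" "\<not> m a" "d = 0 \<or> m d"
    | "a \<noteq> b" "d = a" "c \<noteq> a" "c \<noteq> b" "\<not> m b" "c = 0 \<or> m c"
    | "a \<noteq> b" "d = b" "c \<noteq> a" "c \<noteq> b" "\<not> m a" "c = 0 \<or> m c"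
    | "a = 0" "b = 0" "0 < c" "0 < d" "c \<noteq> d" "m c" "m d"
    | "c = 0" "d = 0" "0 < a" "0 < b" "a \<noteq> b" "\<not> m a" "\<not> m b"
    | "a \<noteq> b" "a \<noteq> c" "a \<noteq> d" "b \<noteq> c" "b \<noteq> d" "c \<noteq> d"
      "\<not> m a" "\<not> m b" "c = 0 \<or> m c" "d = 0 \<or> m d"
    using from_left[of a b] from_left[of b a] from_right[of c d] from_right[of d c] zero
    by (metis neq0_conv)
  thus ?thesis
  proof cases
    case 1 thus ?thesis by (simp add: defs)
  next
    case 2
    show ?thesis
      by (rule compare[OF \<open>d \<noteq> a\<close>]; cases "a = 0"; cases "d = 0")
        (use 2 in \<open>simp_all add: defs algebra_simps\<close>)
  next
    case 3
    show ?thesis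
      by (rule compare[OF \<open>c \<noteq> a\<close>]; cases "a = 0"; cases "c = 0")
        (use 3 in \<open>simp_all add: defs algebra_simps\<close>)
  next
    case 4
    show ?thesis
      by (rule compare[OF \<open>a \<noteq> b\<close>]; cases "a = 0"; cases "b = 0")
        (use 4 in \<open>simp_all add: defs algebra_simps\<close>)
  next
    case 5
    show ?thesis
      by (rule compare[OF \<open>a \<noteq> b\<close>]; cases "a = 0"; cases "b = 0")
        (use 5 in \<open>simp_all add: defs algebra_simps\<close>)
  next
    case 6
    show ?thesis
      by (rule compare[OF \<open>a \<noteq> b\<close>]; cases "a = 0"; cases "b = 0"; cases "m a";
          cases "m b")
        (use 6 in \<open>simp_all add: defs algebra_simps\<close>)
  next
    case 7
    show ?thesis
      by (rule compare[OF \<open>a \<noteq> b\<close>]; cases "a = 0"; cases "b = 0"; cases "m a";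
          cases "m b")
        (use 7 in \<open>simp_all add: defs algebra_simps\<close>)
  next
    case 8
    \<comment> \<open>The calls of \<open>linarith\<close> discard inconsistent orders before the next case split.\<close>
    show ?thesis
      by (rule compare[OF \<open>a \<noteq> b\<close>];
          rule compare[OF \<open>d \<noteq> a\<close>];
          rule compare[OF \<open>d \<noteq> b\<close>]; linarith?; cases "a = 0"; linarith?;
          cases "b = 0"; linarith?; cases "d = 0"; linarith?; cases "m a")
        (use 8 in \<open>simp_all add: defs algebra_simps\<close>)
  next
    case 9
    show ?thesis
      by (rule compare[OF \<open>a \<noteq> b\<close>];
          rule compare[OF \<open>d \<noteq> a\<close>];
          rule compare[OF \<open>d \<noteq> b\<close>]; linarith?; cases "a = 0"; linarith?;
          cases "b = 0"; linarith?; cases "d = 0"; linarith?; cases "m b")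
        (use 9 in \<open>simp_all add: defs algebra_simps\<close>)
  next
    case 10
    show ?thesis
      by (rule compare[OF \<open>a \<noteq> b\<close>];
          rule compare[OF \<open>c \<noteq> a\<close>];
          rule compare[OF \<open>c \<noteq> b\<close>]; linarith?; cases "a = 0"; linarith?;
          cases "b = 0"; linarith?; cases "c = 0"; linarith?; cases "m a")
        (use 10 in \<open>simp_all add: defs algebra_simps\<close>)
  next
    case 11
    show ?thesis
      by (rule compare[OF \<open>a \<noteq> b\<close>];
          rule compare[OF \<open>c \<noteq> a\<close>];
          rule compare[OF \<open>c \<noteq> b\<close>]; linarith?; cases "a = 0"; linarith?;
          cases "b = 0"; linarith?; cases "c = 0"; linarith?; cases "m b")
        (use 11 in \<open>simp_all add: defs algebra_simps\<close>)
  next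
    case 12
    show ?thesis
      by (
          rule compare[OF \<open>c \<noteq> d\<close>]) (use 12 in \<open>simp_all add: defs algebra_simps\<close>)
  next
    case 13
    show ?thesis
      by (
          rule compare[OF \<open>a \<noteq> b\<close>]) (use 13 in \<open>simp_all add: defs algebra_simps\<close>)
  next
    case 14
    show ?thesis
      by (rule compare[OF \<open>a \<noteq> b\<close>];
          rule compare[OF \<open>a \<noteq> c\<close>];
          rule compare[OF \<open>b \<noteq> c\<close>]; linarith?;
          rule compare[OF \<open>a \<noteq> d\<close>]; linarith?;
          rule compare[OF \<open>b \<noteq> d\<close>]; linarith?;
          rule compare[OF \<open>c \<noteq> d\<close>]; linarith?; cases "a = 0"; linarith?;
          cases "b = 0"; linarith?; cases "c = 0"; linarith?; cases "d = 0"; linarith?)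
        (use 14 in \<open>simp_all add: defs algebra_simps\<close>)
  qed
qed

section \<open>Separating the horizontal spins from the other colors at a vertex\<close>

definition level :: "nat option \<Rightarrow> nat" where
  "level = case_option 0 Suc"

lemma level_simps [simp]: "level None = 0" "level (Some c) = Suc c"
  by (simp_all add: level_def)

lemma level_eq_iff [simp]: "level L = level R \<longleftrightarrow> L = R"
  by (cases L; cases R) auto

lemma level_eq_Suc_iff: "level L = Suc e \<longleftrightarrow> L = Some e"
  by (cases L) auto

definition conserves :: "nat option \<Rightarrow> nat set \<Rightarrow> nat option \<Rightarrow> nat set \<Rightarrow> bool" where
  "conserves L S R B \<longleftrightarrow>
     (\<forall>e. of_bool (e \<in> S) + of_bool (L = Some e) = (of_bool (e \<in> B) + of_bool (R = Some e) :: nat))"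

definition occupied :: "nat set \<Rightarrow> nat \<Rightarrow> bool" where
  "occupied S k \<longleftrightarrow> k \<in> Suc ` S"

lemma occupied_simps [simp]: "\<not> occupied S 0" "occupied S (Suc e) \<longleftrightarrow> e \<in> S"
  by (auto simp: occupied_def)

definition left_factors :: "'a::field \<Rightarrow> nat \<Rightarrow> nat set \<Rightarrow> 'a" where
  "left_factors t L S = (\<Prod>e\<in>S. left_factor t L (Suc e))"

definition right_factors :: "nat \<Rightarrow> nat set \<Rightarrow> 'a::field" where
  "right_factors R S = (\<Prod>e\<in>S. right_factor R (Suc e))"

lemma prod_if_power:
  fixes x :: "'a::comm_monoid_mult"
  assumes "finite S"
  shows "(\<Prod>e\<in>S. if P e then x else 1) = x ^ card {e\<in>S. P e}"
  using assms by (simp add: prod.If_cases Int_def)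

lemma left_factor_0: "left_factor t L 0 = 1"
  by (simp add: left_factor_def)

lemma right_factor_0: "right_factor R 0 = 1"
  by (simp add: right_factor_def)

lemma left_factors_0: "left_factors t 0 S = (- t) ^ card S"
  by (simp add: left_factors_def left_factor_def)

lemma left_factors_Suc: "finite S \<Longrightarrow> left_factors t (Suc c) S = (- t) ^ card {e\<in>S. c < e}"
  by (simp add: left_factors_def left_factor_def prod_if_power)

lemma right_factors_0: "right_factors 0 S = 1"
  by (simp add: right_factors_def right_factor_def)

lemma right_factors_Suc: "finite S \<Longrightarrow> right_factors (Suc c) S = (- 1) ^ card {e\<in>S. c < e}"
  by (simp add: right_factors_def right_factor_def prod_if_power)

text \<open>
  The factors of the lower of two vertices are taken over the middle edge. Conservation of colors expresses
  them by the factors over the top edge.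
\<close>
lemma prod_conserved:
  fixes g :: "nat \<Rightarrow> 'a::comm_monoid_mult"
  assumes "conserves L S R B" "finite S" and "g 0 = 1"
  shows "(\<Prod>e\<in>S. g (Suc e)) * g (level L) = (\<Prod>e\<in>B. g (Suc e)) * g (level R)"
proof -
  from assms(1) have c: "of_bool (e \<in> S) + of_bool (L = Some e) = (of_bool (e \<in> B) + of_bool (R = Some e) :: nat)" for e
    by (auto simp: conserves_def)
  have "B \<subseteq> S \<union> set_option L"
  proof
    fix e assume "e \<in> B"
    thus "e \<in> S \<union> set_option L" using c[of e] by (auto simp: of_bool_def split: if_splits)
  qed
  hence finB: "finite B" using assms(2) by (auto intro: finite_subset)
  define U where "U = S \<union> B \<union> set_option L \<union> set_option R"
  have finU: "finite U" using finB assms(2) by (simp add: U_def)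
  have set: "(\<Prod>e\<in>A. g (Suc e)) = (\<Prod>e\<in>U. g (Suc e) ^ of_bool (e \<in> A))" if "A \<subseteq> U" for A
    by (rule prod.mono_neutral_cong_left) (use finU that in auto)
  have spin: "g (level x) = (\<Prod>e\<in>U. g (Suc e) ^ of_bool (x = Some e))" if "set_option x \<subseteq> U" for x
  proof (cases x)
    case None thus ?thesis using assms(3) by simp
  next
    case (Some k)
    have "(\<Prod>e\<in>U. g (Suc e) ^ of_bool (x = Some e)) = (\<Prod>e\<in>U. if e = k then g (Suc k) else 1)"
      by (rule prod.cong) (auto simp: Some)
    also have "\<dots> = g (Suc k)" using finU that Some by (simp add: prod.delta)
    finally show ?thesis using Some by simp
  qed
  have both: "(\<Prod>e\<in>A. g (Suc e)) * g (level x) = (\<Prod>e\<in>U. g (Suc e) ^ (of_bool (e \<in> A) + of_bool (x = Some e)))"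
    if "A \<subseteq> U" "set_option x \<subseteq> U" for A x
    by (simp only: set[OF that(1)] spin[OF that(2)] prod.distrib power_add)
  show ?thesis
    by (simp only: both[of S L] both[of B R] U_def Un_upper1 Un_upper2 le_supI1 le_supI2 subset_refl c)
qed

lemma conserves_None_None: "conserves None S None B \<longleftrightarrow> B = S"
  by (auto simp: conserves_def of_bool_def split: if_splits)

lemma conserves_same: "conserves (Some c) S (Some c) B \<longleftrightarrow> B = S"
  by (auto simp: conserves_def of_bool_def split: if_splits)

lemma conserves_None_Some: "conserves None S (Some c) B \<longleftrightarrow> c \<in> S \<and> B = S - {c}"
  by (auto simp: conserves_def of_bool_def split: if_splits)

lemma conserves_Some_None: "conserves (Some c) S None B \<longleftrightarrow> c \<notin> S \<and> B = S \<union> {c}"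
  by (auto simp: conserves_def of_bool_def split: if_splits)

lemma conserves_Some_Some: "c \<noteq> d \<Longrightarrow> conserves (Some c) S (Some d) B \<longleftrightarrow> d \<in> S \<and> c \<notin> S \<and> B = (S \<union> {c}) - {d}"
  by (auto simp: conserves_def of_bool_def split: if_splits)

lemma rvar_nonzero [simp]: "(rvar v :: 'k::field ratfun) \<noteq> 0"
proof -
  have "Poly_Mapping.single (Poly_Mapping.single v (Suc 0)) (1::'k) \<noteq> 0"
    by (metis lookup_single_eq lookup_zero one_neq_zero)
  thus ?thesis by (simp add: rvar_def Zero_fract_def eq_fract)
qed

lemma card_above_split:
  fixes S :: "nat set"
  assumes "finite S" "a < b"
  shows "card {e\<in>S. a < e} = card {e\<in>S. a < e \<and> e < b} + card {e\<in>S. b < e} + of_bool (b \<in> S)"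
proof -
  have "{e\<in>S. a < e} = {e\<in>S. a < e \<and> e < b} \<union> {e\<in>S. b < e} \<union> (S \<inter> {b})"
    using assms(2) by (auto simp: nat_neq_iff)
  also have "card \<dots> = card {e\<in>S. a < e \<and> e < b} + card {e\<in>S. b < e} + card (S \<inter> {b})"
    using assms by (subst card_Un_disjoint) (auto simp: card_Un_disjoint disjoint_iff)
  finally show ?thesis by (simp add: of_bool_def Int_insert_right)
qed

lemma minus_power_mult: "(- t) ^ k * (- 1) ^ k = (t :: 'a::comm_ring_1) ^ k"
  by (simp add: power_mult_distrib[symmetric])

text \<open>
  The exponents in the six weights count the colors of \<open>S\<close> above, below or between the horizontal
  spins. Each of them splits into a count of colors above the left spin and a count of colors above
  the right spin; this yields the common form of all six weights.
\<close>
lemma vertex_weight_eq: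
  fixes x y :: "'k::field ratfun"
  assumes "finite S"
  shows "tv * vertex_weight x y L S R B =
    (if conserves L S R B
     then left_factors tv (level L) S * right_factors (level R) S *
       local_weight tv (x / y) (level L) (level R) (occupied S (level L)) else 0)"
proof (cases L; cases R)
  assume "L = None" "R = None"
  thus ?thesis
    by (simp add: vertex_weight_def conserves_None_None left_factors_0 right_factors_0 local_weight_def)
next
  fix c assume [simp]: "L = None" "R = Some c"
  have *: "card S = Suc (card {e\<in>S. e < c} + card {e\<in>S. c < e})" if "c \<in> S"
  proof -
    have "S = insert c ({e\<in>S. e < c} \<union> {e\<in>S. c < e})" using that by auto
    hence "card S = card (insert c ({e\<in>S. e < c} \<union> {e\<in>S. c < e}))" by simp
    also have "\<dots> = Suc (card {e\<in>S. e < c} + card {e\<in>S. c < e})"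
      using assms by (subst card_insert_disjoint) (auto simp: card_Un_disjoint disjoint_iff)
    finally show ?thesis .
  qed
  show ?thesis
    using assms
    by (auto simp: vertex_weight_def conserves_None_Some left_factors_0 right_factors_Suc
        local_weight_def * power_add power_mult_distrib[symmetric])
next
  fix c assume [simp]: "L = Some c" "R = None"
  show ?thesis
    using assms
    by (auto simp: vertex_weight_def conserves_Some_None left_factors_Suc right_factors_0 local_weight_def algebra_simps)
next
  fix c d assume [simp]: "L = Some c" "R = Some d"
  show ?thesis
  proof (cases c d rule: linorder_cases)
    case equal
    thus ?thesis using assms
      by (auto simp: vertex_weight_def conserves_same left_factors_Suc right_factors_Suc
          local_weight_def power_mult_distrib[symmetric])
  next
    case less
    have "(- tv) ^ card {e\<in>S. c < e} * (- 1) ^ card {e\<in>S. d < e} =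
        - tv * (- tv) ^ card {e\<in>S. c < e \<and> e < d} * (tv :: 'k ratfun) ^ card {e\<in>S. d < e}"
      if "d \<in> S"
      using that by (simp add: card_above_split[OF assms less] power_add minus_power_mult mult.assoc)
    thus ?thesis using less assms
      by (auto simp: vertex_weight_def conserves_Some_Some left_factors_Suc right_factors_Suc local_weight_def algebra_simps)
  next
    case greater
    have "(- tv) ^ card {e\<in>S. c < e} * (- 1) ^ card {e\<in>S. d < e} =
        (- 1) ^ card {e\<in>S. d < e \<and> e < c} * (tv :: 'k ratfun) ^ card {e\<in>S. c < e}"
      if "c \<notin> S"
      using that by (simp add: card_above_split[OF assms greater] power_add minus_power_mult mult.left_commute)
    thus ?thesis using greater assms
      by (auto simp: vertex_weight_def conserves_Some_Some left_factors_Suc right_factors_Suc local_weight_def algebra_simps)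
  qed
qed

lemma conserves_iff_passable:
  "conserves L S R B \<longleftrightarrow> passable (occupied S) (level L) (level R) \<and>
     B = (if L = R then S else S \<union> set_option L - set_option R)"
proof (cases L; cases R)
  fix c d assume [simp]: "L = Some c" "R = Some d"
  show ?thesis by (cases "c = d") (auto simp: conserves_same conserves_Some_Some passable_def)
qed (auto simp: conserves_None_None conserves_None_Some conserves_Some_None passable_def)

section \<open>The Yang-Baxter equation for a column\<close>

definition pair_weight :: "nat set \<Rightarrow> 'k::field ratfun \<Rightarrow> 'k ratfun \<Rightarrow> 'k ratfun \<Rightarrow>
    nat option \<Rightarrow> nat option \<Rightarrow> nat option \<Rightarrow> nat option \<Rightarrow> nat set \<Rightarrow> nat set \<Rightarrow> 'k ratfun" where
  "pair_weight A x x' y a b c d S B =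
     (\<Sum>U\<in>Pow A. vertex_weight x y a S c U * vertex_weight x' y b U d B)"

text \<open>
  At most one middle edge contributes, namely \<open>S\<close> with \<open>a\<close> added and \<open>c\<close> removed. The factor
  in front of \<open>core_weight\<close> is unchanged when \<open>a\<close>, \<open>b\<close> or \<open>c\<close>, \<open>d\<close> are exchanged.
\<close>
lemma pair_weight_eq:
  fixes x x' y :: "'k::field ratfun"
  assumes A: "finite A" "S \<subseteq> A" "set_option a \<subseteq> A"
  shows "tv ^ 3 * pair_weight A x x' y a b c d S B =
    (if \<forall>e. of_bool (e \<in> S) + of_bool (a = Some e) + of_bool (b = Some e) =
           (of_bool (e \<in> B) + of_bool (c = Some e) + of_bool (d = Some e) :: nat)
     then left_factors tv (level a) S * left_factors tv (level b) S *
       (right_factors (level c) S * right_factors (level d) S) *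
       core_weight tv (x / y) (x' / y) (occupied S) (level a) (level b) (level c) (level d)
     else 0)" (is "_ = (if ?T then _ else 0)")
proof -
  define U where "U = (if a = c then S else S \<union> set_option a - set_option c)"
  have finS: "finite S" using A finite_subset by blast
  have U: "U \<in> Pow A" "finite U" using A finS by (auto simp: U_def)
  let ?pass = "passable (occupied S) (level a) (level c)"
  have vanish: "vertex_weight x y a S c V = 0" if "V \<noteq> U \<or> \<not> ?pass" for V
  proof -
    have "tv * vertex_weight x y a S c V = 0"
      using that by (auto simp: vertex_weight_eq[OF finS] conserves_iff_passable U_def)
    thus ?thesis by simp
  qed
  have sum: "pair_weight A x x' y a b c d S B = vertex_weight x y a S c U * vertex_weight x' y b U d B"
  proof -
    have "pair_weight A x x' y a b c d S B =
        (\<Sum>V\<in>Pow A. if V = U then vertex_weight x y a S c U * vertex_weight x' y b U d B else 0)"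
      unfolding pair_weight_def by (rule sum.cong) (auto simp: vanish)
    thus ?thesis using U A(1) by simp
  qed
  show ?thesis
  proof (cases ?pass)
    case False
    thus ?thesis by (simp add: sum vanish core_weight_def)
  next
    case True
    hence cons: "conserves a S c U" by (simp add: conserves_iff_passable U_def)
    have T: "conserves b U d B \<longleftrightarrow> ?T"
    proof -
      have "of_bool (e \<in> U) + of_bool (b = Some e) = (of_bool (e \<in> B) + of_bool (d = Some e) :: nat) \<longleftrightarrow>
        of_bool (e \<in> S) + of_bool (a = Some e) + of_bool (b = Some e) =
           (of_bool (e \<in> B) + of_bool (c = Some e) + of_bool (d = Some e) :: nat)" for e
        using cons[unfolded conserves_def, rule_format, of e] by linarith
      thus ?thesis by (simp add: conserves_def)
    qed
    have left: "left_factors tv (level b) U * left_factor tv (level b) (level c) =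
        (left_factors tv (level b) S * left_factor tv (level b) (level a) :: 'k ratfun)"
      using prod_conserved[OF cons finS, of "left_factor tv (level b)", OF left_factor_0, symmetric] by (simp only: left_factors_def)
    have right: "right_factors (level d) U * right_factor (level d) (level c) =
        (right_factors (level d) S * right_factor (level d) (level a) :: 'k ratfun)"
      using prod_conserved[OF cons finS, of "right_factor (level d)", OF right_factor_0, symmetric] by (simp only: right_factors_def)
    have lc: "tv = left_factor tv (level b) (level c) * (if level b < level c then - 1 else tv :: 'k ratfun)"
      by (simp add: left_factor_def)
    have rc: "right_factor (level d) (level c) * right_factor (level d) (level c) = (1 :: 'k ratfun)"
      by (simp add: right_factor_def)
    have rs: "right_factors (level d) U =
        (right_factors (level d) S * right_factor (level d) (level a) * right_factor (level d) (level c) :: 'k ratfun)"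
      by (subst right[symmetric], subst mult.assoc, subst rc) (rule mult_1_right[symmetric])
    have combine: "t * (L * R * w) * (l1 * r1 * w') = L * l2 * (R * r2) * (pa * q * ra * rc * w * w')"
      if "t = p * q" "l1 * p = l2 * pa" "r1 = r2 * ra * rc"
      for t p q L R w w' l1 l2 r1 r2 pa ra rc :: "'k ratfun"
    proof -
      have "t * (L * R * w) * (l1 * r1 * w') = (l1 * p) * (q * L * R * w * r2 * ra * rc * w')"
        unfolding that(1,3) by (simp only: mult_ac)
      also have "\<dots> = L * l2 * (R * r2) * (pa * q * ra * rc * w * w')"
        unfolding that(2) by (simp only: mult_ac)
      finally show ?thesis .
    qed
    have occ: "local_weight tv (x' / y) (level b) (level d) (occupied U (level b)) =
        local_weight tv (x' / y) (level b) (level d) (if level a = level c then occupied S (level b)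
             else level b = level a \<or> level b \<noteq> level c \<and> occupied S (level b))"
    proof (cases b)
      case None thus ?thesis by (simp add: local_weight_def)
    next
      case (Some k)
      thus ?thesis 
        using True by (intro arg_cong[of _ _ "local_weight _ _ _ _"]) (cases a; cases c; auto simp: U_def passable_def)
    qed
    have "tv ^ 3 * pair_weight A x x' y a b c d S B =
       tv * (tv * vertex_weight x y a S c U) * (tv * vertex_weight x' y b U d B)"
      by (simp add: sum power3_eq_cube)
    also have "\<dots> = (if ?T then tv * (left_factors tv (level a) S * right_factors (level c) S *
          local_weight tv (x / y) (level a) (level c) (occupied S (level a))) *
         (left_factors tv (level b) U * right_factors (level d) U *
          local_weight tv (x' / y) (level b) (level d) (occupied U (level b))) else 0)"
      by (simp only: vertex_weight_eq[OF finS] vertex_weight_eq[OF U(2)] cons T if_True) simp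
    also have "tv * (left_factors tv (level a) S * right_factors (level c) S *
          local_weight tv (x / y) (level a) (level c) (occupied S (level a))) *
         (left_factors tv (level b) U * right_factors (level d) U *
          local_weight tv (x' / y) (level b) (level d) (occupied U (level b))) =
       left_factors tv (level a) S * left_factors tv (level b) S *
       (right_factors (level c) S * right_factors (level d) S) *
       core_weight tv (x / y) (x' / y) (occupied S) (level a) (level b) (level c) (level d)"
      unfolding core_weight_def if_P[OF True] occ by (rule combine[OF lc left rs])
    finally show ?thesis .
  qed
qed

text \<open>
  On the left-hand side the crossing precedes the column, whose upper vertex has parameter \<open>x\<close>; on
  the right-hand side it follows the column, whose upper vertex has parameter \<open>x'\<close>. By color
  conservation a crossing has at most two outcomes, so each side has two terms.
\<close>
lemma vertex_yang_baxter:
  fixes x x' y :: "'k::field ratfun"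
  assumes A: "finite A" "S \<subseteq> A" "set_option a \<subseteq> A" "set_option b \<subseteq> A" and y: "y \<noteq> 0"
  shows "R_diag tv x x' (level a) (level b) * pair_weight A x x' y a b c d S B +
         R_swap tv x x' (level a) (level b) * pair_weight A x x' y b a c d S B =
         R_diag tv x x' (level c) (level d) * pair_weight A x' x y a b c d S B +
         R_swap tv x x' (level d) (level c) * pair_weight A x' x y a b d c S B"
    (is "?lhs = ?rhs")
proof -
  let ?T = "\<forall>e. of_bool (e \<in> S) + of_bool (a = Some e) + of_bool (b = Some e) =
           (of_bool (e \<in> B) + of_bool (c = Some e) + of_bool (d = Some e) :: nat)"
  let ?K = "left_factors tv (level a) S * left_factors tv (level b) S *
       (right_factors (level c) S * right_factors (level d) S) :: 'k ratfun"
  let ?core_weight = "\<lambda>z z'. core_weight tv (z / y) (z' / y) (occupied S)"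
  have diag: "R_diag tv x x' k l = y * R_diag tv (x / y) (x' / y) k l" for k l
    using y by (simp add: R_diag_def field_simps)
  have swap: "R_swap tv x x' k l = y * R_swap tv (x / y) (x' / y) k l" for k l
    using y by (simp add: R_swap_def field_simps)
  have 1: "tv ^ 3 * pair_weight A z z' y a b c d S B =
      (if ?T then ?K * ?core_weight z z' (level a) (level b) (level c) (level d) else 0)" for z z'
    by (rule pair_weight_eq) fact+
  have 2: "tv ^ 3 * pair_weight A z z' y b a c d S B =
      (if ?T then ?K * ?core_weight z z' (level b) (level a) (level c) (level d) else 0)" for z z'
    using pair_weight_eq[OF A(1,2,4), of z z' y a c d B] by (simp only: add_ac mult_ac)
  have 3: "tv ^ 3 * pair_weight A z z' y a b d c S B =
      (if ?T then ?K * ?core_weight z z' (level a) (level b) (level d) (level c) else 0)" for z z'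
    using pair_weight_eq[OF A(1-3), of z z' y b d c B] by (simp only: add_ac mult_ac)
  have "tv ^ 3 * ?lhs = tv ^ 3 * ?rhs"
  proof (cases ?T)
    case True
    have "tv ^ 3 * ?lhs = y *
       (R_diag tv (x/y) (x'/y) (level a) (level b) * (tv ^ 3 * pair_weight A x x' y a b c d S B) +
        R_swap tv (x/y) (x'/y) (level a) (level b) * (tv ^ 3 * pair_weight A x x' y b a c d S B))"
      unfolding diag swap by (simp only: distrib_left mult_ac)
    also have "\<dots> = y * ?K *
       (R_diag tv (x/y) (x'/y) (level a) (level b) * ?core_weight x x' (level a) (level b) (level c) (level d) +
        R_swap tv (x/y) (x'/y) (level a) (level b) * ?core_weight x x' (level b) (level a) (level c) (level d))"
      unfolding 1 2 if_P[OF True] by (simp only: distrib_left mult_ac)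
    also have "\<dots> = y * ?K *
       (R_diag tv (x/y) (x'/y) (level c) (level d) * ?core_weight x' x (level a) (level b) (level c) (level d) +
        R_swap tv (x/y) (x'/y) (level d) (level c) * ?core_weight x' x (level a) (level b) (level d) (level c))"
    proof -
      have "of_bool (occupied S e) + of_bool (level a = e) + of_bool (level b = e) =
         (of_bool (occupied B e) + of_bool (level c = e) + of_bool (level d = e) :: nat)" if "0 < e" for e
        using that True[rule_format, of "e - 1"]
        by (cases e) (simp_all add: level_eq_Suc_iff)
      from core_weight_yang_baxter[OF _ _ this, of tv "x/y" "x'/y"] show ?thesis by simp
    qed
    also have "\<dots> = y *
       (R_diag tv (x/y) (x'/y) (level c) (level d) * (tv ^ 3 * pair_weight A x' x y a b c d S B) +
        R_swap tv (x/y) (x'/y) (level d) (level c) * (tv ^ 3 * pair_weight A x' x y a b d c S B))"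
      unfolding 1 3 if_P[OF True] by (simp only: distrib_left mult_ac)
    also have "\<dots> = tv ^ 3 * ?rhs"
      unfolding diag swap by (simp only: distrib_left mult_ac)
    finally show ?thesis .
  next
    case False
    have "tv ^ 3 * pair_weight A z z' y a b c d S B = 0" "tv ^ 3 * pair_weight A z z' y b a c d S B = 0"
      "tv ^ 3 * pair_weight A z z' y a b d c S B = 0" for z z'
      using False by (simp_all only: 1 2 3 if_False)
    thus ?thesis by simp
  qed
  thus ?thesis by simp
qed

section \<open>The partition function as a product of transfer matrices\<close>

text \<open>
  \<open>transfer A M k a b\<close> is the entry \<open>(a, b)\<close> of the matrix product \<open>M 1 \<cdots> M k\<close> with index set \<open>A\<close>. A row of the
  lattice is such a product over its columns, from right to left, and the whole lattice is such a
  product over its rows.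
\<close>
primrec transfer :: "'s set \<Rightarrow> (nat \<Rightarrow> 's \<Rightarrow> 's \<Rightarrow> 'a::comm_semiring_1) \<Rightarrow> nat \<Rightarrow> 's \<Rightarrow> 's \<Rightarrow> 'a" where
  "transfer A M 0 a b = of_bool (a = b)"
| "transfer A M (Suc k) a b = (\<Sum>c\<in>A. transfer A M k a c * M (Suc k) c b)"

lemma transfer_cong:
  assumes "\<And>j c d. j \<in> {1..k} \<Longrightarrow> M j c d = M' j c d"
  shows "transfer A M k a b = transfer A M' k a b"
  using assms by (induction k arbitrary: b) auto

lemma transfer_paths:
  assumes A: "finite A" "a \<in> A" "b \<in> A"
  shows "(\<Sum>g | g \<in> {0..k} \<rightarrow>\<^sub>E A \<and> g 0 = a \<and> g k = b. \<Prod>i\<in>{1..k}. M i (g (i - 1)) (g i)) =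
    transfer A M k a b"
  using A(3)
proof (induction k arbitrary: b)
  case 0
  have "{g. g \<in> {0..0::nat} \<rightarrow>\<^sub>E A \<and> g 0 = a \<and> g 0 = b} =
      (if a = b then {(\<lambda>i\<in>{0}. a)} else {})"
    using A(2) by (auto simp: PiE_iff extensional_def fun_eq_iff)
  thus ?case by simp
next
  case (Suc k)
  let ?G = "\<lambda>c. {g. g \<in> {0..k} \<rightarrow>\<^sub>E A \<and> g 0 = a \<and> g k = c}"
  let ?G' = "{g. g \<in> {0..Suc k} \<rightarrow>\<^sub>E A \<and> g 0 = a \<and> g (Suc k) = b}"
  have fin: "finite (?G c)" for c
    by (rule finite_subset[of _ "{0..k} \<rightarrow>\<^sub>E A"]) (auto intro: finite_PiE A)
  have fin': "finite ?G'"
    by (rule finite_subset[of _ "{0..Suc k} \<rightarrow>\<^sub>E A"]) (auto intro!: finite_PiE A)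
  have "(\<Sum>g\<in>?G'. \<Prod>i\<in>{1..Suc k}. M i (g (i - 1)) (g i)) =
      (\<Sum>c\<in>A. \<Sum>g | g \<in> ?G' \<and> g k = c. \<Prod>i\<in>{1..Suc k}. M i (g (i - 1)) (g i))"
    by (rule sum.group[symmetric]) (use fin' A in \<open>auto simp: PiE_iff\<close>)
  also have "\<dots> = (\<Sum>c\<in>A. \<Sum>g\<in>?G c. (\<Prod>i\<in>{1..k}. M i (g (i - 1)) (g i)) * M (Suc k) c b)"
  proof (rule sum.cong[OF refl])
    fix c assume "c \<in> A"
    show "(\<Sum>g | g \<in> ?G' \<and> g k = c. \<Prod>i\<in>{1..Suc k}. M i (g (i - 1)) (g i)) =
        (\<Sum>g\<in>?G c. (\<Prod>i\<in>{1..k}. M i (g (i - 1)) (g i)) * M (Suc k) c b)"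
    proof (rule sum.reindex_bij_witness[of _ "\<lambda>g. g(Suc k := b)" "\<lambda>g. restrict g {0..k}"])
      fix g assume g: "g \<in> {g. g \<in> ?G' \<and> g k = c}"
      show "(restrict g {0..k})(Suc k := b) = g"
        using g by (auto simp: fun_eq_iff PiE_iff extensional_def)
      show "restrict g {0..k} \<in> ?G c" using g by (auto simp: PiE_iff)
      have "(\<Prod>i\<in>{1..k}. M i (g (i - 1)) (g i)) =
          (\<Prod>i\<in>{1..k}. M i (restrict g {0..k} (i - 1)) (restrict g {0..k} i))"
        by (rule prod.cong) auto
      thus "(\<Prod>i\<in>{1..k}. M i (restrict g {0..k} (i - 1)) (restrict g {0..k} i)) * M (Suc k) c b =
          (\<Prod>i\<in>{1..Suc k}. M i (g (i - 1)) (g i))"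
        using g by (simp add: mult.commute)
    next
      fix g assume g: "g \<in> ?G c"
      show "restrict (g(Suc k := b)) {0..k} = g"
        using g by (auto simp: fun_eq_iff PiE_iff extensional_def)
      show "g(Suc k := b) \<in> {g. g \<in> ?G' \<and> g k = c}"
        using g Suc.prems by (auto simp: PiE_iff extensional_def)
    qed
  qed
  also have "\<dots> = (\<Sum>c\<in>A. transfer A M k a c * M (Suc k) c b)"
    by (rule sum.cong[OF refl]) (simp only: Suc.IH sum_distrib_right[symmetric])
  finally show ?case by simp
qed

lemma sum_PiE_curry:
  "(\<Sum>h | h \<in> I \<times> J \<rightarrow>\<^sub>E A \<and> P (\<lambda>i\<in>I. \<lambda>j\<in>J. h (i, j)). f (\<lambda>i\<in>I. \<lambda>j\<in>J. h (i, j))) =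
   (\<Sum>g | g \<in> I \<rightarrow>\<^sub>E (J \<rightarrow>\<^sub>E A) \<and> P g. f g)"
proof (rule sum.reindex_bij_witness[of _ "\<lambda>g. \<lambda>(i, j)\<in>I \<times> J. g i j" "\<lambda>h. \<lambda>i\<in>I. \<lambda>j\<in>J. h (i, j)"])
  fix g assume g: "g \<in> {g. g \<in> I \<rightarrow>\<^sub>E (J \<rightarrow>\<^sub>E A) \<and> P g}"
  show *: "(\<lambda>i\<in>I. \<lambda>j\<in>J. (\<lambda>(i, j)\<in>I \<times> J. g i j) (i, j)) = g"
  proof
    fix i
    show "(\<lambda>i\<in>I. \<lambda>j\<in>J. (\<lambda>(i, j)\<in>I \<times> J. g i j) (i, j)) i = g i"
      using g by (cases "i \<in> I") (auto simp: PiE_iff extensional_def fun_eq_iff)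
  qed
  show "(\<lambda>(i, j)\<in>I \<times> J. g i j) \<in> {h. h \<in> I \<times> J \<rightarrow>\<^sub>E A \<and> P (\<lambda>i\<in>I. \<lambda>j\<in>J. h (i, j))}"
    unfolding mem_Collect_eq * using g by (auto simp: PiE_iff)
qed (auto simp: PiE_iff extensional_def fun_eq_iff)

text \<open>
  Summing over the vertical edges between two rows turns the pair of rows into a single row of
  stacked vertices.
\<close>
lemma transfer_product:
  "(\<Sum>U\<in>{1..k} \<rightarrow>\<^sub>E P. transfer A (\<lambda>j r l. F j r l (U j)) k a a' * transfer A (\<lambda>j r l. G j r l (U j)) k b b') =
   transfer (A \<times> A) (\<lambda>j (r, r') (l, l'). \<Sum>u\<in>P. F j r l u * G j r' l' u) k (a, b) (a', b')"
proof (induction k arbitrary: a' b')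
  case 0
  show ?case by simp
next
  case (Suc k)
  let ?tF = "\<lambda>U. transfer A (\<lambda>j r l. F j r l (U j)) k a"
  let ?tG = "\<lambda>U. transfer A (\<lambda>j r l. G j r l (U j)) k b"
  have "(\<Sum>U\<in>{1..Suc k} \<rightarrow>\<^sub>E P. transfer A (\<lambda>j r l. F j r l (U j)) (Suc k) a a' *
          transfer A (\<lambda>j r l. G j r l (U j)) (Suc k) b b') =
     (\<Sum>(u, U)\<in>P \<times> ({1..k} \<rightarrow>\<^sub>E P).
        (\<Sum>c\<in>A. ?tF U c * F (Suc k) c a' u) * (\<Sum>d\<in>A. ?tG U d * G (Suc k) d b' u))"
  proof (rule sum.reindex_bij_witness[of _ "\<lambda>(u, U). U(Suc k := u)" "\<lambda>U. (U (Suc k), restrict U {1..k})"])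
    fix U assume U: "U \<in> {1..Suc k} \<rightarrow>\<^sub>E P"
    show "(case (U (Suc k), restrict U {1..k}) of (u, U) \<Rightarrow> U(Suc k := u)) = U"
      using U by (auto simp: fun_eq_iff PiE_iff extensional_def)
    show "(U (Suc k), restrict U {1..k}) \<in> P \<times> ({1..k} \<rightarrow>\<^sub>E P)"
      using U by (auto simp: PiE_iff)
    have "?tF (restrict U {1..k}) c = ?tF U c" "?tG (restrict U {1..k}) c = ?tG U c" for c
      by (rule transfer_cong; simp)+
    thus "(case (U (Suc k), restrict U {1..k}) of (u, U) \<Rightarrow>
        (\<Sum>c\<in>A. ?tF U c * F (Suc k) c a' u) * (\<Sum>d\<in>A. ?tG U d * G (Suc k) d b' u)) =
      transfer A (\<lambda>j r l. F j r l (U j)) (Suc k) a a' * transfer A (\<lambda>j r l. G j r l (U j)) (Suc k) b b'"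
      by simp
  next
    fix uU assume "uU \<in> P \<times> ({1..k} \<rightarrow>\<^sub>E P)"
    thus "((case uU of (u, U) \<Rightarrow> U(Suc k := u)) (Suc k), restrict (case uU of (u, U) \<Rightarrow> U(Suc k := u)) {1..k}) = uU"
      "(case uU of (u, U) \<Rightarrow> U(Suc k := u)) \<in> {1..Suc k} \<rightarrow>\<^sub>E P"
      by (auto simp: fun_eq_iff PiE_iff extensional_def)
  qed
  also have "\<dots> = (\<Sum>U\<in>{1..k} \<rightarrow>\<^sub>E P. \<Sum>u\<in>P. \<Sum>c\<in>A. \<Sum>d\<in>A.
      ?tF U c * ?tG U d * (F (Suc k) c a' u * G (Suc k) d b' u))"
    by (subst sum.cartesian_product[symmetric], subst sum.swap) (simp only: sum_product mult_ac)
  also have "\<dots> = (\<Sum>c\<in>A. \<Sum>d\<in>A. \<Sum>U\<in>{1..k} \<rightarrow>\<^sub>E P. \<Sum>u\<in>P.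
      ?tF U c * ?tG U d * (F (Suc k) c a' u * G (Suc k) d b' u))"
    by (subst (2) sum.swap, subst sum.swap, rule sum.cong[OF refl], subst (2) sum.swap, subst sum.swap, rule refl)
  also have "\<dots> = (\<Sum>c\<in>A. \<Sum>d\<in>A. (\<Sum>U\<in>{1..k} \<rightarrow>\<^sub>E P. ?tF U c * ?tG U d) *
      (\<Sum>u\<in>P. F (Suc k) c a' u * G (Suc k) d b' u))"
    by (simp only: sum_product)
  also have "\<dots> = transfer (A \<times> A) (\<lambda>j (r, r') (l, l'). \<Sum>u\<in>P. F j r l u * G j r' l' u) (Suc k) (a, b) (a', b')"
    unfolding Suc.IH transfer.simps
    by (subst sum.cartesian_product, intro sum.cong refl) auto
  finally show ?case .
qed

definition spins :: "nat \<Rightarrow> nat option set" where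
  "spins n = insert None (Some ` {1..n})"

lemma finite_spins [simp]: "finite (spins n)"
  by (simp add: spins_def)

definition row_weight :: "nat \<Rightarrow> nat \<Rightarrow> 'k::field ratfun \<Rightarrow> nat option \<Rightarrow> (nat \<Rightarrow> nat set) \<Rightarrow> (nat \<Rightarrow> nat set) \<Rightarrow> 'k ratfun" where
  "row_weight n N x R S B =
     transfer (spins n) (\<lambda>j r l. vertex_weight x (yv j) l (S j) r (B j)) N R None"

abbreviation column_states :: "nat \<Rightarrow> nat \<Rightarrow> (nat \<Rightarrow> nat set) set" where
  "column_states n N \<equiv> {1..N} \<rightarrow>\<^sub>E Pow {1..n}"

definition rows_weight :: "nat \<Rightarrow> nat \<Rightarrow> (nat \<Rightarrow> nat) \<Rightarrow> nat \<Rightarrow> (nat \<Rightarrow> nat set) \<Rightarrow> (nat \<Rightarrow> nat set) \<Rightarrow> 'k::field ratfun" where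
  "rows_weight n N w = transfer (column_states n N) (\<lambda>i S B. row_weight n N (xv i) (Some (w i)) S B)"

lemma top_boundary_in_column_states:
  assumes "\<sigma> permutes {1..n}"
  shows "restrict (top_boundary n lam \<sigma>) {1..N} \<in> column_states n N"
proof (rule restrict_PiE_iff[THEN iffD2], intro ballI PowI subsetI)
  fix j c assume "c \<in> top_boundary n lam \<sigma> j"
  then obtain i where "i \<in> {1..n}" "c = \<sigma> (n + 1 - i)" by (auto simp: top_boundary_def)
  moreover have "n + 1 - i \<in> {1..n}" using \<open>i \<in> {1..n}\<close> by auto
  ultimately show "c \<in> {1..n}" using permutes_in_image[OF assms] by simp
qed

lemma partition_function_eq_rows_weight:
  assumes w: "w permutes {1..n}" and \<sigma>: "\<sigma> permutes {1..n}"
  shows "partition_function n N lam \<sigma> w =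
    (rows_weight n N w n (restrict (top_boundary n lam \<sigma>) {1..N}) (\<lambda>j\<in>{1..N}. {}) :: 'k::field ratfun)"
proof -
  define row where "row i S B h =
     (\<Prod>j\<in>{1..N}. vertex_weight (xv i) (yv j) (h j) (S j) (h (j - 1)) (B j) :: 'k ratfun)"
    for i :: nat and S B :: "nat \<Rightarrow> nat set" and h
  define H where "H = {h. h \<in> {1..n} \<times> {0..N} \<rightarrow>\<^sub>E spins n \<and>
      (\<forall>i\<in>{1..n}. (\<lambda>i\<in>{1..n}. \<lambda>j\<in>{0..N}. h (i, j)) i 0 = Some (w i) \<and>
        (\<lambda>i\<in>{1..n}. \<lambda>j\<in>{0..N}. h (i, j)) i N = None)}"
  define start where "start = restrict (top_boundary n lam \<sigma>) {1..N}"
  define V where "V = {v. v \<in> {0..n} \<times> {1..N} \<rightarrow>\<^sub>E Pow {1..n} \<and>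
      ((\<lambda>i\<in>{0..n}. \<lambda>j\<in>{1..N}. v (i, j)) 0 = start \<and>
        (\<lambda>i\<in>{0..n}. \<lambda>j\<in>{1..N}. v (i, j)) n = (\<lambda>j\<in>{1..N}. {}))}"
  have states: "states n N lam \<sigma> w = H \<times> V"
    unfolding states_def H_def V_def start_def spins_def
    by (auto simp: fun_eq_iff)
  let ?c = "\<lambda>v. \<lambda>i\<in>{0..n}. \<lambda>j\<in>{1..N}. v (i, j)"
  let ?d = "\<lambda>h. \<lambda>i\<in>{1..n}. \<lambda>j\<in>{0..N}. h (i, j)"
  have "partition_function n N lam \<sigma> w = (\<Sum>(h, v)\<in>H \<times> V.
      \<Prod>i\<in>{1..n}. row i (?c v (i - 1)) (?c v i) (?d h i))"
    unfolding partition_function_def states row_def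
    by (intro sum.cong refl) (auto intro!: prod.cong)
  also have "\<dots> = (\<Sum>v\<in>V. \<Sum>h\<in>H. \<Prod>i\<in>{1..n}. row i (?c v (i - 1)) (?c v i) (?d h i))"
    by (subst sum.cartesian_product[symmetric], subst sum.swap) (rule refl)
  also have "\<dots> = (\<Sum>v\<in>V. \<Prod>i\<in>{1..n}. row_weight n N (xv i) (Some (w i)) (?c v (i - 1)) (?c v i))"
  proof (rule sum.cong[OF refl])
    fix v
    let ?G = "\<lambda>i. {h. h \<in> {0..N} \<rightarrow>\<^sub>E spins n \<and> h 0 = Some (w i) \<and> h N = None}"
    have "(\<Sum>h\<in>H. \<Prod>i\<in>{1..n}. row i (?c v (i - 1)) (?c v i) (?d h i)) =
        (\<Sum>g | g \<in> {1..n} \<rightarrow>\<^sub>E ({0..N} \<rightarrow>\<^sub>E spins n) \<and> (\<forall>i\<in>{1..n}. g i 0 = Some (w i) \<and> g i N = None).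
          \<Prod>i\<in>{1..n}. row i (?c v (i - 1)) (?c v i) (g i))"
      unfolding H_def by (rule sum_PiE_curry)
    also have "{g. g \<in> {1..n} \<rightarrow>\<^sub>E ({0..N} \<rightarrow>\<^sub>E spins n) \<and> (\<forall>i\<in>{1..n}. g i 0 = Some (w i) \<and> g i N = None)} =
        PiE {1..n} ?G"
      by (auto simp: PiE_def Pi_def)
    also have "(\<Sum>g\<in>PiE {1..n} ?G. \<Prod>i\<in>{1..n}. row i (?c v (i - 1)) (?c v i) (g i)) =
        (\<Prod>i\<in>{1..n}. \<Sum>h\<in>?G i. row i (?c v (i - 1)) (?c v i) h)"
      by (rule prod_sum_PiE[symmetric])
        (auto intro!: finite_subset[of _ "{0..N} \<rightarrow>\<^sub>E spins n"] finite_PiE)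
    also have "\<dots> = (\<Prod>i\<in>{1..n}. row_weight n N (xv i) (Some (w i)) (?c v (i - 1)) (?c v i))"
    proof (rule prod.cong[OF refl])
      fix i assume "i \<in> {1..n}"
      hence "Some (w i) \<in> spins n" using permutes_in_image[OF w] by (auto simp: spins_def)
      moreover have "None \<in> spins n" by (simp add: spins_def)
      ultimately show "(\<Sum>h\<in>?G i. row i (?c v (i - 1)) (?c v i) h) =
          row_weight n N (xv i) (Some (w i)) (?c v (i - 1)) (?c v i)"
        unfolding row_def row_weight_def by (rule transfer_paths[OF finite_spins])
    qed
    finally show "(\<Sum>h\<in>H. \<Prod>i\<in>{1..n}. row i (?c v (i - 1)) (?c v i) (?d h i)) =
        (\<Prod>i\<in>{1..n}. row_weight n N (xv i) (Some (w i)) (?c v (i - 1)) (?c v i))" .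
  qed
  also have "\<dots> = (\<Sum>g | g \<in> {0..n} \<rightarrow>\<^sub>E column_states n N \<and> g 0 = start \<and> g n = (\<lambda>j\<in>{1..N}. {}).
      \<Prod>i\<in>{1..n}. row_weight n N (xv i) (Some (w i)) (g (i - 1)) (g i))"
    unfolding V_def by (rule sum_PiE_curry)
  also have "\<dots> = rows_weight n N w n start (\<lambda>j\<in>{1..N}. {})"
    unfolding rows_weight_def
  proof (rule transfer_paths)
    show "finite (column_states n N)" by (auto intro: finite_PiE)
    show "start \<in> column_states n N" unfolding start_def by (rule top_boundary_in_column_states[OF \<sigma>])
  qed auto
  finally show ?thesis by (simp only: start_def)
qed

section \<open>Exchanging two adjacent rows\<close>

definition row_pair_weight where
  "row_pair_weight n k x x' S B =
     transfer (spins n \<times> spins n)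
       (\<lambda>j (r, r') (l, l'). pair_weight {1..n} x x' (yv j) l l' r r' (S j) (B j)) k"

lemma row_pair_weight_eq:
  "(\<Sum>U\<in>column_states n N. row_weight n N x r S U * row_weight n N x' r' U B) =
     row_pair_weight n N x x' S B (r, r') (None, None)"
  unfolding row_weight_def row_pair_weight_def pair_weight_def
  by (rule transfer_product)

text \<open>The crossing moves from the left to the right, by one column in each induction step.\<close>
lemma row_pair_yang_baxter:
  fixes x x' :: "'k::field ratfun"
  assumes "a \<in> spins n" "b \<in> spins n" and "\<And>j. j \<in> {1..k} \<Longrightarrow> S j \<subseteq> {1..n}"
  shows "R_diag tv x x' (level a) (level b) * row_pair_weight n k x x' S B (c, d) (a, b) +
         R_swap tv x x' (level a) (level b) * row_pair_weight n k x x' S B (c, d) (b, a) =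
         R_diag tv x x' (level c) (level d) * row_pair_weight n k x' x S B (c, d) (a, b) +
         R_swap tv x x' (level d) (level c) * row_pair_weight n k x' x S B (d, c) (a, b)"
  using assms
proof (induction k arbitrary: a b)
  case 0
  show ?case by (auto simp: row_pair_weight_def R_swap_def)
next
  case (Suc k)
  let ?D = "\<lambda>a b. R_diag tv x x' (level a) (level b)"
  let ?O = "\<lambda>a b. R_swap tv x x' (level a) (level b)"
  let ?P = "\<lambda>p q. row_pair_weight n k x x' S B p q"
  let ?P' = "\<lambda>p q. row_pair_weight n k x' x S B p q"
  let ?C = "\<lambda>a b e f. pair_weight {1..n} x x' (yv (Suc k)) a b e f (S (Suc k)) (B (Suc k))"
  let ?C' = "\<lambda>a b e f. pair_weight {1..n} x' x (yv (Suc k)) a b e f (S (Suc k)) (B (Suc k))"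
  let ?sum = "\<lambda>F. \<Sum>e\<in>spins n. \<Sum>f\<in>spins n. F e f"
  have step: "row_pair_weight n (Suc k) z z' S B p (a, b) = (?sum (\<lambda>e f.
      row_pair_weight n k z z' S B p (e, f) * pair_weight {1..n} z z' (yv (Suc k)) a b e f (S (Suc k)) (B (Suc k))))"
    for z z' p a b
    by (simp add: row_pair_weight_def sum.cartesian_product split_beta)
  have colors: "set_option a \<subseteq> {1..n}" "set_option b \<subseteq> {1..n}"
    using Suc.prems by (auto simp: spins_def)
  have yb: "?D a b * ?C a b e f + ?O a b * ?C b a e f = ?D e f * ?C' a b e f + ?O f e * ?C' a b f e" for e f
    by (rule vertex_yang_baxter) (use colors Suc.prems(3) in auto)
  have IH: "?D e f * ?P p (e, f) + ?O e f * ?P p (f, e) = ?D (fst p) (snd p) * ?P' p (e, f) +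
      ?O (snd p) (fst p) * ?P' (snd p, fst p) (e, f)" if "e \<in> spins n" "f \<in> spins n" "p = (c, d)" for e f p
    using Suc.IH[OF that(1,2)] Suc.prems(3) that(3) by simp
  have "?D a b * row_pair_weight n (Suc k) x x' S B (c, d) (a, b) +
      ?O a b * row_pair_weight n (Suc k) x x' S B (c, d) (b, a) =
      ?sum (\<lambda>e f. ?P (c, d) (e, f) * (?D a b * ?C a b e f + ?O a b * ?C b a e f))"
    unfolding step sum_distrib_left sum.distrib[symmetric] by (intro sum.cong refl) (simp only: distrib_left mult_ac)
  also have "\<dots> = ?sum (\<lambda>e f. ?D e f * ?P (c, d) (e, f) * ?C' a b e f) +
      ?sum (\<lambda>e f. ?O f e * ?P (c, d) (e, f) * ?C' a b f e)"
    unfolding yb sum.distrib[symmetric] by (intro sum.cong refl) (simp only: distrib_left mult_ac)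
  also have "?sum (\<lambda>e f. ?O f e * ?P (c, d) (e, f) * ?C' a b f e) = ?sum (\<lambda>e f. ?O e f * ?P (c, d) (f, e) * ?C' a b e f)"
    by (rule sum.swap)
  also have "?sum (\<lambda>e f. ?D e f * ?P (c, d) (e, f) * ?C' a b e f) + \<dots> =
      ?sum (\<lambda>e f. (?D e f * ?P (c, d) (e, f) + ?O e f * ?P (c, d) (f, e)) * ?C' a b e f)"
    unfolding sum.distrib[symmetric] by (intro sum.cong refl) (simp only: distrib_right)
  also have "\<dots> = ?sum (\<lambda>e f. (?D c d * ?P' (c, d) (e, f) + ?O d c * ?P' (d, c) (e, f)) * ?C' a b e f)"
    by (intro sum.cong refl) (simp add: IH)
  also have "\<dots> = ?D c d * row_pair_weight n (Suc k) x' x S B (c, d) (a, b) +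
         ?O d c * row_pair_weight n (Suc k) x' x S B (d, c) (a, b)"
    unfolding step sum_distrib_left sum.distrib[symmetric]
    by (intro sum.cong refl) (simp only: distrib_left distrib_right mult_ac)
  finally show ?case .
qed

text \<open>
  With uncolored left boundary the crossing has a single outcome on the left. The weights of
  the crossing on the right are the coefficients of \<open>\<tau>\<^sub>i\<close>, up to the denominator \<open>x' - x\<close>.
\<close>
lemma row_pair_ascent:
  fixes x x' :: "'k::field ratfun"
  assumes "a < b" and "\<And>j. j \<in> {1..N} \<Longrightarrow> S j \<subseteq> {1..n}"
  shows "(x' - x) * row_pair_weight n N x x' S B (Some a, Some b) (None, None) =
    (tv - 1) * x' * row_pair_weight n N x x' S B (Some b, Some a) (None, None) +
    (x - tv * x') * row_pair_weight n N x' x S B (Some b, Some a) (None, None)"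
  using row_pair_yang_baxter[where x = x' and x' = x and a = None and b = None and c = "Some b" and d = "Some a" and n = n and k = N and S = S and B = B] assms
  by (simp add: R_diag_def R_swap_def spins_def algebra_simps)

section \<open>The operators \<open>\<tau>\<^sub>i\<close> acting on the rows of the lattice\<close>

lemma s_act_0 [simp]: "s_act i 0 = (0 :: 'k::field ratfun)"
  using s_act_add[of i "0 :: 'k ratfun" 0] by (metis add_cancel_right_right add_0)

lemma s_act_1 [simp]: "s_act i 1 = (1 :: 'k::field ratfun)"
  using s_act_mult[of i "tv :: 'k ratfun" 1] by (simp add: s_act_rvar)

lemma s_act_minus [simp]: "s_act i (- f) = - s_act i (f :: 'k::field ratfun)"
  using s_act_add[of i f "- f"] by (simp add: eq_neg_iff_add_eq_0 add.commute)

lemma s_act_diff [simp]: "s_act i (f - g) = s_act i f - s_act i (g :: 'k::field ratfun)"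
  using s_act_add[of i f "- g"] by simp

lemma s_act_power [simp]: "s_act i (f ^ k) = s_act i (f :: 'k::field ratfun) ^ k"
  by (induction k) (simp_all add: s_act_mult)

lemma s_act_divide [simp]: "s_act i (f / g) = s_act i f / s_act i (g :: 'k::field ratfun)"
proof -
  have inv: "s_act i (inverse g) = inverse (s_act i g)"
  proof (cases "g = 0")
    case False
    hence "s_act i g * s_act i (inverse g) = 1" by (simp add: s_act_mult[symmetric])
    thus ?thesis by (metis inverse_unique)
  qed simp
  show ?thesis by (simp add: divide_inverse s_act_mult inv)
qed

lemma s_act_sum: "s_act i (\<Sum>a\<in>A. f a) = (\<Sum>a\<in>A. s_act i (f a) :: 'k::field ratfun)"
  by (induction A rule: infinite_finite_induct) (simp_all add: s_act_add)

lemma s_act_tv [simp]: "s_act i tv = (tv :: 'k::field ratfun)"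
  and s_act_yv [simp]: "s_act i (yv j) = (yv j :: 'k::field ratfun)"
  and s_act_xv: "s_act i (xv k) = (xv (Transposition.transpose i (Suc i) k) :: 'k::field ratfun)"
  by (simp_all add: s_act_rvar)

lemma s_act_s_act [simp]: "s_act i (s_act i f) = (f :: 'k::field ratfun)"
  by (cases f) (simp add: s_act_Fract)

lemma s_act_vertex_weight:
  "s_act i (vertex_weight x (yv j) L S R B) = (vertex_weight (s_act i x) (yv j) L S R B :: 'k::field ratfun)"
  by (simp add: vertex_weight_def s_act_mult s_act_add split: option.split)

lemma s_act_transfer:
  "s_act i (transfer A M k a b) = (transfer A (\<lambda>j c d. s_act i (M j c d)) k a b :: 'k::field ratfun)"
  by (induction k arbitrary: b) (simp_all add: s_act_sum s_act_mult of_bool_def)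

lemma s_act_row_weight:
  "s_act i (row_weight n N x R S B) = (row_weight n N (s_act i x) R S B :: 'k::field ratfun)"
  unfolding row_weight_def s_act_transfer s_act_vertex_weight by simp

lemma rvar_eq_iff: "(rvar u :: 'k::field ratfun) = rvar v \<longleftrightarrow> u = v"
proof
  assume "(rvar u :: 'k ratfun) = rvar v"
  hence "Poly_Mapping.single (Poly_Mapping.single u (Suc 0)) (1::'k) = Poly_Mapping.single (Poly_Mapping.single v (Suc 0)) 1"
    by (simp add: rvar_def eq_fract)
  hence "Poly_Mapping.single u (Suc 0) = Poly_Mapping.single v (Suc 0)"
    by (metis lookup_single_eq lookup_single_not_eq one_neq_zero)
  thus "u = v" by (metis lookup_single_eq lookup_single_not_eq nat.distinct(1))
qed simp

text \<open>Clearing denominators brings \<open>\<tau>\<^sub>i\<close> into the form in which it arises from the crossing of two rows.\<close>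
lemma tau_gen_eq_iff:
  fixes f g :: "'k::field ratfun"
  shows "g = tau_gen i f \<longleftrightarrow>
    (xv (Suc i) - xv i) * g = (tv - 1) * xv (Suc i) * f + (xv i - tv * xv (Suc i)) * s_act i f"
proof -
  let ?x = "xv i :: 'k ratfun" and ?x' = "xv (Suc i) :: 'k ratfun"
  have ne: "?x' - ?x \<noteq> 0" by (simp add: rvar_eq_iff)
  have x': "?x' \<noteq> 0" by simp
  have d: "1 - xalpha i = (?x' - ?x) / ?x'" "xalpha i - tv = (?x - tv * ?x') / ?x'"
    by (simp_all add: xalpha_def field_simps)
  have eq: "tau_gen i f = ((tv - 1) * ?x' * f + (?x - tv * ?x') * s_act i f) / (?x' - ?x)"
    using x' by (simp add: tau_gen_def d add_divide_distrib)
  show ?thesis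
    by (subst eq, subst nonzero_eq_divide_eq[OF ne], subst mult.commute[of g]) (rule refl)
qed

text \<open>
  The rows above row \<open>i\<close> are fixed by \<open>s\<^sub>i\<close>, so the two-row identity gives the claim for \<open>k = i + 1\<close>. The
  rows below row \<open>i + 1\<close> are fixed by \<open>s\<^sub>i\<close> too, so \<open>\<tau>\<^sub>i\<close> commutes with multiplication by their weights.
\<close>
lemma rows_weight_exchange:
  fixes w :: "nat \<Rightarrow> nat"
  assumes i: "1 \<le> i" "i < n" and "w i < w (Suc i)" and start: "start \<in> column_states n N" and k: "Suc i \<le> k"
  shows "rows_weight n N w k start B =
    tau_gen i (rows_weight n N (w \<circ> Transposition.transpose i (Suc i)) k start B :: 'k::field ratfun)"
  using k
proof (induction k arbitrary: B rule: dec_induct)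
  case base
  let ?K = "column_states n N"
  let ?w = "w \<circ> Transposition.transpose i (Suc i)"
  let ?x = "xv i :: 'k ratfun" and ?x' = "xv (Suc i) :: 'k ratfun"
  obtain i' where i': "i = Suc i'" using i by (cases i) auto
  define f where "f S = (rows_weight n N w i' start S :: 'k ratfun)" for S
  have f': "rows_weight n N ?w i' start S = f S" for S
    unfolding f_def rows_weight_def by (rule transfer_cong) (auto simp: i' transpose_def)
  have sf: "s_act i (f S) = f S" for S
    unfolding f_def rows_weight_def s_act_transfer s_act_row_weight s_act_xv
    by (rule transfer_cong) (auto simp: i' transpose_def)
  have two: "rows_weight n N v (Suc i) start B = (\<Sum>S\<in>?K. rows_weight n N v i' start S *
      row_pair_weight n N ?x ?x' S B (Some (v i), Some (v (Suc i))) (None, None))" for v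
  proof -
    have "rows_weight n N v (Suc i) start B = (\<Sum>U\<in>?K. \<Sum>S\<in>?K. rows_weight n N v i' start S *
        (row_weight n N ?x (Some (v i)) S U * row_weight n N ?x' (Some (v (Suc i))) U B))"
      by (simp add: rows_weight_def i' sum_distrib_right mult.assoc)
    also have "\<dots> = (\<Sum>S\<in>?K. rows_weight n N v i' start S *
      row_pair_weight n N ?x ?x' S B (Some (v i), Some (v (Suc i))) (None, None))"
      by (subst sum.swap) (simp only: sum_distrib_left[symmetric] row_pair_weight_eq)
    finally show ?thesis .
  qed
  have s_two: "s_act i (row_pair_weight n N ?x ?x' S B (r, r') (None, None)) =
      row_pair_weight n N ?x' ?x S B (r, r') (None, None)" for S r r'
    unfolding row_pair_weight_eq[symmetric] s_act_sum s_act_mult s_act_row_weight s_act_xv by simp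
  have "(?x' - ?x) * rows_weight n N w (Suc i) start B =
     (\<Sum>S\<in>?K. f S * ((?x' - ?x) * row_pair_weight n N ?x ?x' S B (Some (w i), Some (w (Suc i))) (None, None)))"
    unfolding two f_def sum_distrib_left by (simp only: mult_ac)
  also have "\<dots> = (\<Sum>S\<in>?K. f S * (
      (tv - 1) * ?x' * row_pair_weight n N ?x ?x' S B (Some (w (Suc i)), Some (w i)) (None, None) +
      (?x - tv * ?x') * row_pair_weight n N ?x' ?x S B (Some (w (Suc i)), Some (w i)) (None, None)))"
  proof (intro sum.cong refl arg_cong2[of _ _ _ _ "(*)"] row_pair_ascent assms)
    fix S j assume "S \<in> ?K" "j \<in> {1..N}"
    thus "S j \<subseteq> {1..n}" by (auto simp: PiE_iff)
  qed
  also have "\<dots> = (tv - 1) * ?x' * rows_weight n N ?w (Suc i) start B +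
      (?x - tv * ?x') * s_act i (rows_weight n N ?w (Suc i) start B)"
    unfolding two[of ?w] f' s_act_sum s_act_mult s_two sf sum_distrib_left sum.distrib[symmetric]
    by (intro sum.cong refl) (simp only: distrib_left mult_ac comp_apply transpose_apply_first transpose_apply_second)
  finally show ?case unfolding tau_gen_eq_iff .
next
  case (step k)
  let ?w = "w \<circ> Transposition.transpose i (Suc i)"
  have k: "i \<noteq> Suc k" "i \<noteq> k" "Suc k \<noteq> Suc i" using step by auto
  have same: "?w (Suc k) = w (Suc k)" using k by (simp add: transpose_def)
  have inv: "s_act i (row_weight n N (xv (Suc k)) R S B) = (row_weight n N (xv (Suc k)) R S B :: 'k ratfun)" for R S
    using k by (simp add: s_act_row_weight s_act_xv transpose_def)
  have lin: "tau_gen i (\<Sum>S\<in>A. g S * h S) = (\<Sum>S\<in>A. tau_gen i (g S) * h S)"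
    if "\<And>S. s_act i (h S) = h S" for A :: "'b set" and g h :: "'b \<Rightarrow> 'k ratfun"
    unfolding tau_gen_def s_act_sum s_act_mult that sum_distrib_left sum.distrib[symmetric]
    by (intro sum.cong refl) (simp only: distrib_left distrib_right mult_ac)
  show ?case
    using step.IH[unfolded rows_weight_def]
    by (simp only: rows_weight_def transfer.simps same lin[OF inv])
qed

section \<open>Coxeter length as number of inversions\<close>

definition inversions :: "nat \<Rightarrow> (nat \<Rightarrow> nat) \<Rightarrow> (nat \<times> nat) set" where
  "inversions n w = {(a, b). 1 \<le> a \<and> a < b \<and> b \<le> n \<and> w b < w a}"

lemma finite_inversions: "finite (inversions n w)"
  by (rule finite_subset[of _ "{1..n} \<times> {1..n}"]) (auto simp: inversions_def)

text \<open>
  Exchanging two adjacent positions matches the inversions before and after, except for the pair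
  of the two positions itself.
\<close>
lemma card_inversions_ascent:
  assumes i: "1 \<le> i" "i < n" and asc: "w i < w (Suc i)"
  shows "card (inversions n (w \<circ> Transposition.transpose i (Suc i))) = Suc (card (inversions n w))"
proof -
  define s where "s = Transposition.transpose i (Suc i)"
  have s_eq: "s a = (if a = i then Suc i else if a = Suc i then i else a)" for a
    by (simp add: s_def transpose_def)
  have s_s [simp]: "s (s a) = a" for a by (simp add: s_eq)
  have s_i [simp]: "s i = Suc i" "s (Suc i) = i" by (simp_all add: s_eq)
  have s_less: "s a < s b" if "a < b" "(a, b) \<noteq> (i, Suc i)" for a b
    using that unfolding s_eq by (cases "a = i"; cases "a = Suc i"; cases "b = i"; cases "b = Suc i") simp_all
  have range: "1 \<le> s a" "s a \<le> n" if "1 \<le> a" "a \<le> n" for a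
    using i that unfolding s_eq by simp_all
  let ?f = "\<lambda>(a, b). (s a, s b)"
  have swap: "(s a, s b) \<in> inversions n v" if "(a, b) \<in> inversions n (v \<circ> s)" "(a, b) \<noteq> (i, Suc i)" for a b v
    using that range[of a] range[of b] s_less[of a b] unfolding inversions_def by simp
  have "inversions n (w \<circ> s) = insert (i, Suc i) (?f ` inversions n w)"
  proof (intro equalityI subrelI)
    fix a b assume ab: "(a, b) \<in> inversions n (w \<circ> s)"
    show "(a, b) \<in> insert (i, Suc i) (?f ` inversions n w)"
    proof (cases "(a, b) = (i, Suc i)")
      case False
      have "?f (s a, s b) \<in> ?f ` inversions n w" by (rule imageI) (rule swap[OF ab False])
      thus ?thesis by simp
    qed simp
  next
    fix a b assume "(a, b) \<in> insert (i, Suc i) (?f ` inversions n w)"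
    thus "(a, b) \<in> inversions n (w \<circ> s)"
    proof
      assume "(a, b) = (i, Suc i)"
      thus ?thesis using i asc by (simp add: inversions_def)
    next
      assume "(a, b) \<in> ?f ` inversions n w"
      then obtain p where p: "(a, b) = ?f p" "p \<in> inversions n w" by (rule imageE)
      obtain c d where "p = (c, d)" by (cases p)
      with p have cd: "(c, d) \<in> inversions n w" "a = s c" "b = s d" by simp_all
      have "w \<circ> s \<circ> s = w" by (simp add: fun_eq_iff)
      moreover have "(c, d) \<noteq> (i, Suc i)" using cd(1) asc by (auto simp: inversions_def)
      ultimately show ?thesis using swap[of c d "w \<circ> s"] cd by simp
    qed
  qed
  moreover have "(i, Suc i) \<notin> ?f ` inversions n w"
  proof
    assume "(i, Suc i) \<in> ?f ` inversions n w"
    then obtain p where p: "(i, Suc i) = ?f p" "p \<in> inversions n w" by (rule imageE)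
    obtain a b where "p = (a, b)" by (cases p)
    with p have ab: "(a, b) \<in> inversions n w" "i = s a" "Suc i = s b" by simp_all
    have "a = s i" "b = s (Suc i)" using ab(2,3) by simp_all
    thus False using ab(1) by (simp add: inversions_def)
  qed
  moreover have "inj_on ?f (inversions n w)"
    by (rule inj_on_inverseI[of _ ?f]) auto
  ultimately have "card (inversions n (w \<circ> s)) = Suc (card (inversions n w))"
    by (simp only: card_insert_disjoint card_image finite_imageI finite_inversions not_False_eq_True)
  thus ?thesis by (simp only: s_def)
qed

lemma card_inversions_descent:
  assumes i: "1 \<le> i" "i < n" and desc: "w (Suc i) < w i"
  shows "card (inversions n w) = Suc (card (inversions n (w \<circ> Transposition.transpose i (Suc i))))"
proof -
  let ?s = "Transposition.transpose i (Suc i)"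
  have "w \<circ> ?s \<circ> ?s = w" by (simp add: fun_eq_iff)
  thus ?thesis using card_inversions_ascent[OF i, of "w \<circ> ?s"] desc by simp
qed

lemma s_prod_snoc: "s_prod (is @ [i]) = s_prod is \<circ> Transposition.transpose i (Suc i)"
  by (induction "is") (simp_all add: s_prod_def comp_assoc)

lemma s_prod_permutes: "set is \<subseteq> {1..<n} \<Longrightarrow> s_prod is permutes {1..n}"
proof (induction "is" rule: rev_induct)
  case Nil thus ?case by (simp add: s_prod_def permutes_def)
next
  case (snoc i "is")
  have "Transposition.transpose i (Suc i) permutes {1..n}"
    using snoc.prems by (intro permutes_swap_id) auto
  thus ?case using snoc unfolding s_prod_snoc by (intro permutes_compose) auto
qed

lemma card_inversions_s_prod_le:
  "set is \<subseteq> {1..<n} \<Longrightarrow> card (inversions n (s_prod is)) \<le> length is"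
proof (induction "is" rule: rev_induct)
  case Nil
  have "inversions n (\<lambda>x. x) = {}" by (auto simp: inversions_def)
  thus ?case by (simp add: s_prod_def id_def)
next
  case (snoc i "is")
  have "s_prod is i \<noteq> s_prod is (Suc i)"
    using permutes_inj[OF s_prod_permutes[of "is" n]] snoc.prems by (simp add: inj_eq)
  hence "s_prod is i < s_prod is (Suc i) \<or> s_prod is (Suc i) < s_prod is i"
    by (simp add: nat_neq_iff)
  moreover have "card (inversions n (s_prod is)) \<le> length is" "1 \<le> i" "i < n" using snoc by auto
  ultimately have "card (inversions n (s_prod is \<circ> Transposition.transpose i (Suc i))) \<le> Suc (length is)"
    using card_inversions_ascent[of i n "s_prod is"] card_inversions_descent[of i n "s_prod is"]
    by linarith
  thus ?case by (simp only: s_prod_snoc length_append list.size)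
qed

text \<open>A permutation without descents satisfies \<open>a \<le> w a\<close> for all \<open>a\<close>, and only the identity does.\<close>
lemma no_descent_imp_id:
  assumes w: "w permutes {1..n}" and asc: "\<And>i. 1 \<le> i \<Longrightarrow> i < n \<Longrightarrow> w i < w (Suc i)"
  shows "w = id"
proof -
  have "a \<le> w a" if "a \<in> {1..n}" for a
    using that
  proof (induction a)
    case (Suc a)
    show ?case
    proof (cases "a = 0")
      case True
      thus ?thesis using permutes_in_image[OF w, of 1] Suc.prems by simp
    next
      case False
      hence "a \<le> w a" "w a < w (Suc a)" using Suc asc[of a] by auto
      thus ?thesis by simp
    qed
  qed simp
  thus ?thesis by (intro permutes_natset_ge[OF w]) blast
qed

lemma exists_word:
  assumes "w permutes {1..n}"
  shows "\<exists>is. word_for n w is \<and> length is = card (inversions n w)"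
  using assms
proof (induction "card (inversions n w)" arbitrary: w)
  case 0
  have "w i < w (Suc i)" if "1 \<le> i" "i < n" for i
  proof -
    have "inversions n w = {}" using 0 finite_inversions by simp
    hence "\<not> w (Suc i) < w i" using that by (auto simp: inversions_def)
    moreover have "w i \<noteq> w (Suc i)" using permutes_inj[OF 0(2)] by (simp add: inj_eq)
    ultimately show ?thesis by simp
  qed
  hence "w = id" by (rule no_descent_imp_id[OF 0(2)])
  hence "word_for n w []" by (simp add: word_for_def s_prod_def)
  moreover have "length [] = card (inversions n w)" using 0(1) by (simp only: list.size)
  ultimately show ?case by blast
next
  case (Suc l)
  have "\<exists>i. 1 \<le> i \<and> i < n \<and> \<not> w i < w (Suc i)"
  proof (rule ccontr)
    assume "\<not> ?thesis"
    hence "w = id" by (intro no_descent_imp_id[OF Suc.prems]) simp_all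
    hence "inversions n w = {}" by (simp add: inversions_def)
    thus False using Suc.hyps(2) by simp
  qed
  then obtain i where i: "1 \<le> i" "i < n" "\<not> w i < w (Suc i)" by blast
  let ?s = "Transposition.transpose i (Suc i)"
  have "w i \<noteq> w (Suc i)" using permutes_inj[OF Suc.prems] by (simp add: inj_eq)
  hence card: "card (inversions n w) = Suc (card (inversions n (w \<circ> ?s)))"
    using i by (intro card_inversions_descent) simp_all
  have "?s permutes {1..n}" using i by (intro permutes_swap_id) auto
  hence perm: "w \<circ> ?s permutes {1..n}" using Suc.prems by (rule permutes_compose)
  have l: "l = card (inversions n (w \<circ> ?s))" using Suc.hyps(2) card by linarith
  obtain "is" where "is": "word_for n (w \<circ> ?s) is" "length is = card (inversions n (w \<circ> ?s))"
    using Suc.hyps(1)[OF l perm] by blast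
  have "w \<circ> ?s \<circ> ?s = w" by (simp add: fun_eq_iff)
  hence "s_prod (is @ [i]) = w" using "is"(1) by (simp only: word_for_def s_prod_snoc)
  hence "word_for n w (is @ [i])" using "is"(1) i by (simp add: word_for_def)
  moreover have "length (is @ [i]) = card (inversions n w)" unfolding card "is"(2)[symmetric] by simp
  ultimately show ?case by blast
qed

lemma coxeter_length_eq:
  assumes "w permutes {1..n}"
  shows "coxeter_length n w = card (inversions n w)"
  unfolding coxeter_length_def
proof (rule Least_equality)
  show "\<exists>is. word_for n w is \<and> length is = card (inversions n w)"
    by (rule exists_word[OF assms])
  show "card (inversions n w) \<le> l" if "\<exists>is. word_for n w is \<and> length is = l" for l
  proof -
    from that obtain "is" where "word_for n w is" "length is = l" by blast
    thus ?thesis using card_inversions_s_prod_le[of "is" n] by (simp add: word_for_def)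
  qed
qed

lemma reduced_word_some:
  assumes "w permutes {1..n}"
  shows "reduced_word n w (SOME is. reduced_word n w is)"
proof (rule someI_ex)
  show "\<exists>is. reduced_word n w is"
    using exists_word[OF assms] by (simp add: reduced_word_def coxeter_length_eq[OF assms])
qed

section \<open>Independence of the right boundary\<close>

lemma tau_word_snoc: "tau_word (is @ [i]) f = tau_word is (tau_gen i f)"
  by (induction "is") (simp_all add: tau_word_def)

text \<open>
  In a reduced word each letter increases the number of inversions by one. So the permutation given by
  the word without its last letter \<open>i\<close> has an ascent at \<open>i\<close>, and \<open>rows_weight_exchange\<close> removes that letter.
\<close>
lemma tau_word_rows_weight:
  assumes start: "start \<in> column_states n N"
    and "set is \<subseteq> {1..<n}" "length is = card (inversions n (s_prod is))"
  shows "tau_word is (rows_weight n N (s_prod is) n start B :: 'k::field ratfun) = rows_weight n N id n start B"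
  using assms(2,3)
proof (induction "is" rule: rev_induct)
  case Nil
  show ?case by (simp add: tau_word_def s_prod_def)
next
  case (snoc i "is")
  let ?w = "s_prod is"
  have i: "1 \<le> i" "i < n" and "is": "set is \<subseteq> {1..<n}" using snoc.prems by auto
  have len: "Suc (length is) = card (inversions n (?w \<circ> Transposition.transpose i (Suc i)))"
    using snoc.prems(2) by (simp only: s_prod_snoc length_append list.size add_Suc_right add_0_right)
  have "?w i \<noteq> ?w (Suc i)" using permutes_inj[OF s_prod_permutes[OF "is"]] by (simp add: inj_eq)
  moreover have "\<not> ?w (Suc i) < ?w i"
    using card_inversions_descent[OF i, of ?w] card_inversions_s_prod_le[OF "is"] len by linarith
  ultimately have asc: "?w i < ?w (Suc i)" by simp
  have "length is = card (inversions n ?w)"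
    using card_inversions_ascent[OF i asc] len by linarith
  hence "tau_word is (rows_weight n N ?w n start B) = (rows_weight n N id n start B :: 'k ratfun)"
    by (rule snoc.IH[OF "is"])
  moreover have "rows_weight n N ?w n start B = tau_gen i (rows_weight n N (s_prod (is @ [i])) n start B :: 'k ratfun)"
    unfolding s_prod_snoc using i by (intro rows_weight_exchange asc start) simp_all
  ultimately show ?case by (simp only: tau_word_snoc)
qed

lemma tau_rows_weight:
  assumes "start \<in> column_states n N" "w permutes {1..n}"
  shows "tau n w (rows_weight n N w n start B :: 'k::field ratfun) = rows_weight n N id n start B"
proof -
  define ws where "ws = (SOME is. reduced_word n w is)"
  have "reduced_word n w ws" unfolding ws_def by (rule reduced_word_some[OF assms(2)])
  hence "set ws \<subseteq> {1..<n}" "s_prod ws = w" "length ws = card (inversions n w)"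
    by (simp_all add: reduced_word_def word_for_def coxeter_length_eq[OF assms(2)])
  thus ?thesis
    using tau_word_rows_weight[OF assms(1), of ws B] by (simp add: tau_def ws_def)
qed

text \<open>
  If \<open>\<tau>\<^sub>i d = 0\<close>, then applying \<open>s\<^sub>i\<close> gives a second linear relation between \<open>d\<close> and \<open>s\<^sub>i d\<close>. The determinant
  of the two relations is \<open>t (x\<^sub>i - x\<^bsub>i+1\<^esub>)\<^sup>2\<close> up to sign, which is not zero.
\<close>
lemma inj_tau_gen: "inj (tau_gen i :: 'k::field ratfun \<Rightarrow> 'k ratfun)"
proof (rule injI)
  fix f g :: "'k ratfun" assume eq: "tau_gen i f = tau_gen i g"
  let ?x = "xv i :: 'k ratfun" and ?x' = "xv (Suc i) :: 'k ratfun"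
  define d where "d = f - g"
  have "(tv - 1) * ?x' * f + (?x - tv * ?x') * s_act i f = (tv - 1) * ?x' * g + (?x - tv * ?x') * s_act i g"
    using tau_gen_eq_iff[THEN iffD1, OF refl, of i f] tau_gen_eq_iff[THEN iffD1, OF refl, of i g]
    unfolding eq by (simp only:)
  hence 1: "(tv - 1) * ?x' * d + (?x - tv * ?x') * s_act i d = 0"
    unfolding d_def s_act_diff by algebra
  have 2: "(tv - 1) * ?x * s_act i d + (?x' - tv * ?x) * d = 0"
    using arg_cong[OF 1, of "s_act i"] by (simp add: s_act_add s_act_mult s_act_xv)
  have "tv * (?x - ?x')^2 * d = (tv - 1) * ?x * ((tv - 1) * ?x' * d + (?x - tv * ?x') * s_act i d) -
      (?x - tv * ?x') * ((tv - 1) * ?x * s_act i d + (?x' - tv * ?x) * d)"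
    by (simp add: algebra_simps power2_eq_square)
  also have "\<dots> = 0" by (simp only: 1 2) simp
  finally have "d = 0" by (simp add: rvar_eq_iff)
  thus "f = g" by (simp add: d_def)
qed

lemma inj_tau_word: "inj (tau_word is :: 'k::field ratfun \<Rightarrow> 'k ratfun)"
proof (induction "is")
  case Nil
  show ?case by (simp add: tau_word_def)
next
  case (Cons i "is")
  have "tau_word (i # is) = (tau_gen i \<circ> tau_word is :: 'k ratfun \<Rightarrow> _)" by (simp add: tau_word_def)
  thus ?case using inj_compose[OF inj_tau_gen Cons.IH] by (simp only:)
qed

lemma tau_gen_tv: "tau_gen i (tv ^ k * f) = (tv ^ k * tau_gen i f :: 'k::field ratfun)"
  by (simp add: tau_gen_def s_act_mult distrib_left mult_ac)

lemma tau_word_tv: "tau_word is (tv ^ k * f) = (tv ^ k * tau_word is f :: 'k::field ratfun)"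
  by (induction "is") (simp_all add: tau_word_def tau_gen_tv)

section \<open>The boundary condition with a single state\<close>

lemma vertex_weight_foreign:
  assumes "c \<notin> S"
  shows "vertex_weight x y L S (Some c) B =
    (if L = Some c \<and> B = S then tv ^ card {e\<in>S. c < e} * (1 - x / y) else (0 :: 'k::field ratfun))"
  using assms by (cases L) (auto simp: vertex_weight_def)

lemma vertex_weight_pick_least:
  assumes "c \<in> S" "\<And>e. e \<in> S \<Longrightarrow> c \<le> e"
  shows "vertex_weight x y None S (Some c) B =
    (if B = S - {c} then tv ^ card {e\<in>S. c < e} else (0 :: 'k::field ratfun))"
proof -
  have "{e\<in>S. e < c} = {}" using assms(2) by (auto simp: not_less)
  hence none: "card {e\<in>S. e < c} = 0" by (simp only: card.empty)
  show ?thesis using assms(1) by (simp add: vertex_weight_def none)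
qed

lemma vertex_weight_empty:
  "vertex_weight x y None {} R B = (if R = None \<and> B = {} then 1 else (0 :: 'k::field ratfun))"
  by (cases R) (auto simp: vertex_weight_def)

text \<open>
  If \<open>c\<close> occurs only in column \<open>p\<close> and all columns further left are empty, a row that emits \<open>c\<close> on the right
  can pick it up only in column \<open>p\<close>, must be uncolored before and must carry \<open>c\<close> afterwards.
\<close>
lemma row_weight_leftmost_color:
  assumes p: "p \<in> {1..N}" and c: "c \<in> S p" "c \<in> {1..n}" and least: "\<And>e. e \<in> S p \<Longrightarrow> c \<le> e"
    and once: "\<And>j. j \<in> {1..N} \<Longrightarrow> j \<noteq> p \<Longrightarrow> c \<notin> S j"
    and left: "\<And>j. p < j \<Longrightarrow> j \<le> N \<Longrightarrow> S j = {}"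
  shows "row_weight n N x (Some c) S B =
    (if \<forall>j\<in>{1..N}. B j = S j - {c}
     then (\<Prod>j\<in>{1..<p}. 1 - x / yv j) * tv ^ (\<Sum>j\<in>{1..p}. card {e\<in>S j. c < e})
     else (0 :: 'k::field ratfun))"
proof -
  let ?M = "\<lambda>j r l. vertex_weight x (yv j) l (S j) r (B j) :: 'k ratfun"
  let ?T = "\<lambda>k. transfer (spins n) ?M k (Some c)"
  let ?E = "\<lambda>k. tv ^ (\<Sum>j\<in>{1..k}. card {e\<in>S j. c < e}) :: 'k ratfun"
  have spin: "Some c \<in> spins n" "None \<in> spins n" using c by (auto simp: spins_def)
  obtain p' where p': "p = Suc p'" using p by (cases p) auto
  have right: "?T k l = (if l = Some c \<and> (\<forall>j\<in>{1..k}. B j = S j - {c})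
      then (\<Prod>j\<in>{1..k}. 1 - x / yv j) * ?E k else 0)" if "k < p" for k l
    using that
  proof (induction k arbitrary: l)
    case 0
    show ?case by simp
  next
    case (Suc k)
    have notin: "c \<notin> S (Suc k)" using once[of "Suc k"] Suc.prems p by auto
    have "?T (Suc k) l = (\<Sum>m\<in>spins n. if m = Some c then ?T k (Some c) * ?M (Suc k) (Some c) l else 0)"
      unfolding transfer.simps
    proof (rule sum.cong[OF refl])
      fix m
      show "?T k m * ?M (Suc k) m l = (if m = Some c then ?T k (Some c) * ?M (Suc k) (Some c) l else 0)"
        by (cases "m = Some c") (use Suc.IH[of m] Suc.prems in simp_all)
    qed
    also have "\<dots> = ?T k (Some c) * ?M (Suc k) (Some c) l" using spin by simp
    finally show ?case
      using Suc.IH[of "Some c"] Suc.prems notin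
      by (simp add: vertex_weight_foreign atLeastAtMostSuc_conv power_add mult_ac)
  qed
  have "?T k None = (if \<forall>j\<in>{1..k}. B j = S j - {c}
      then (\<Prod>j\<in>{1..<p}. 1 - x / yv j) * ?E p else 0)" if "p \<le> k" "k \<le> N" for k
    using that
  proof (induction k rule: dec_induct)
    case base
    have "?T (Suc p') None = (\<Sum>m\<in>spins n. if m = Some c then ?T p' (Some c) * ?M (Suc p') (Some c) None else 0)"
      unfolding transfer.simps
    proof (rule sum.cong[OF refl])
      fix m
      show "?T p' m * ?M (Suc p') m None = (if m = Some c then ?T p' (Some c) * ?M (Suc p') (Some c) None else 0)"
        by (cases "m = Some c") (use right[of p' m] p' in simp_all)
    qed
    also have "\<dots> = ?T p' (Some c) * ?M (Suc p') (Some c) None" using spin by simp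
    moreover have "?M p (Some c) None = (if B p = S p - {c} then tv ^ card {e\<in>S p. c < e} else 0)"
      by (rule vertex_weight_pick_least[OF c(1) least])
    ultimately show ?case
      using right[of p' "Some c"] unfolding p'
      by (simp add: atLeastAtMostSuc_conv atLeastLessThanSuc_atLeastAtMost power_add mult_ac)
  next
    case (step k)
    have empty: "S (Suc k) = {}" using left[of "Suc k"] step by simp
    have "?T (Suc k) None = (\<Sum>m\<in>spins n. if m = None then ?T k None * of_bool (B (Suc k) = {}) else 0)"
      unfolding transfer.simps empty vertex_weight_empty
      by (rule sum.cong) auto
    also have "\<dots> = ?T k None * of_bool (B (Suc k) = {})" using spin by simp
    finally show ?case
      using step empty by (auto simp: atLeastAtMostSuc_conv)
  qed
  from this[of N] p show ?thesis by (simp add: row_weight_def)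
qed

text \<open>
  Row \<open>i\<close> emits \<open>v i\<close>, which enters at the top of column \<open>lam i\<close>. As \<open>lam\<close> is weakly decreasing, each row
  finds its color in the leftmost nonempty column, and by \<open>asc\<close> it is the least color there. So after
  \<open>k\<close> rows only the state \<open>S k\<close>, in which the first \<open>k\<close> colors have been removed, has a nonzero weight.
\<close>
lemma rows_weight_block_ascending:
  fixes v lam :: "nat \<Rightarrow> nat"
  assumes v: "v permutes {1..n}"
    and lam: "\<And>i j. 1 \<le> i \<Longrightarrow> i \<le> j \<Longrightarrow> j \<le> n \<Longrightarrow> lam j \<le> lam i" "\<And>i. i \<in> {1..n} \<Longrightarrow> lam i \<in> {1..N}"
    and asc: "\<And>i j. 1 \<le> i \<Longrightarrow> i < j \<Longrightarrow> j \<le> n \<Longrightarrow> lam i = lam j \<Longrightarrow> v i < v j"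
    and k: "k \<le> n" and B: "B \<in> column_states n N"
  defines "S \<equiv> \<lambda>k. \<lambda>j\<in>{1..N}. {v m | m. m \<in> {k<..n} \<and> lam m = j}"
  shows "rows_weight n N v k (S 0) B = (if B = S k
     then \<Prod>i\<in>{1..k}. (\<Prod>j\<in>{1..<lam i}. 1 - xv i / yv j) * tv ^ card {m\<in>{i..n}. v i < v m}
     else (0 :: 'k::field ratfun))"
  using k B
proof (induction k arbitrary: B)
  case 0
  show ?case by (auto simp: rows_weight_def)
next
  case (Suc k)
  let ?i = "Suc k"
  let ?W = "\<lambda>i. (\<Prod>j\<in>{1..<lam i}. 1 - xv i / yv j) * tv ^ card {m\<in>{i..n}. v i < v m} :: 'k ratfun"
  have inj: "v a = v b \<longleftrightarrow> a = b" for a b using permutes_inj[OF v] by (simp add: inj_eq)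
  have img: "v m \<in> {1..n}" if "m \<in> {1..n}" for m using that by (simp only: permutes_in_image[OF v])
  have i: "?i \<in> {1..n}" using Suc.prems by simp
  have S_state: "S l \<in> column_states n N" for l
    unfolding S_def using img by (auto simp: Ball_def)
  have S_mem: "e \<in> S k j \<longleftrightarrow> (\<exists>m\<in>{?i..n}. e = v m \<and> lam m = j)" if "j \<in> {1..N}" for e j
    using that by (auto simp: S_def)
  have row: "row_weight n N (xv ?i) (Some (v ?i)) (S k) B = (if \<forall>j\<in>{1..N}. B j = S k j - {v ?i}
     then (\<Prod>j\<in>{1..<lam ?i}. 1 - xv ?i / yv j) * tv ^ (\<Sum>j\<in>{1..lam ?i}. card {e\<in>S k j. v ?i < e})
     else (0 :: 'k ratfun))"
  proof (rule row_weight_leftmost_color)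
    show p: "lam ?i \<in> {1..N}" by (rule lam(2)[OF i])
    show "v ?i \<in> S k (lam ?i)" using i by (auto simp: S_mem[OF p])
    show "v ?i \<in> {1..n}" by (rule img[OF i])
    fix e assume "e \<in> S k (lam ?i)"
    then obtain m where m: "m \<in> {?i..n}" "e = v m" "lam m = lam ?i" by (auto simp: S_mem[OF p])
    show "v ?i \<le> e" using asc[of ?i m] m by (cases "m = ?i") auto
  next
    fix j assume "j \<in> {1..N}" "j \<noteq> lam ?i"
    thus "v ?i \<notin> S k j" by (auto simp: S_mem inj)
  next
    fix j assume j: "lam ?i < j" "j \<le> N"
    hence "j \<in> {1..N}" by simp
    have "lam m \<noteq> j" if "m \<in> {?i..n}" for m using lam(1)[of ?i m] that j by auto
    thus "S k j = {}" using S_mem[OF \<open>j \<in> {1..N}\<close>] by blast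
  qed
  have next_state: "(\<forall>j\<in>{1..N}. B j = S k j - {v ?i}) \<longleftrightarrow> B = S ?i"
  proof -
    have "S k j - {v ?i} = S ?i j" if "j \<in> {1..N}" for j
    proof -
      have "{k<..n} = insert ?i {?i<..n}" using Suc.prems by auto
      thus ?thesis using that by (auto simp: S_def inj)
    qed
    moreover have "B \<in> extensional {1..N}" "S ?i \<in> extensional {1..N}"
      using Suc.prems S_state[of ?i] by (auto simp: PiE_iff)
    ultimately show ?thesis by (auto intro: extensionalityI)
  qed
  have exponent: "(\<Sum>j\<in>{1..lam ?i}. card {e\<in>S k j. v ?i < e}) = card {m\<in>{?i..n}. v ?i < v m}"
  proof -
    have "card {e\<in>S k j. v ?i < e} = (\<Sum>m | m \<in> {m\<in>{?i..n}. v ?i < v m} \<and> lam m = j. 1)"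
      if "j \<in> {1..lam ?i}" for j
    proof -
      have "j \<in> {1..N}" using that lam(2)[OF i] by auto
      hence "{e\<in>S k j. v ?i < e} = v ` {m \<in> {m\<in>{?i..n}. v ?i < v m}. lam m = j}"
        by (auto simp: S_mem)
      thus ?thesis by (simp add: card_image inj_on_def inj)
    qed
    hence "(\<Sum>j\<in>{1..lam ?i}. card {e\<in>S k j. v ?i < e}) =
        (\<Sum>j\<in>{1..lam ?i}. \<Sum>m | m \<in> {m\<in>{?i..n}. v ?i < v m} \<and> lam m = j. 1)"
      by (rule sum.cong[OF refl])
    also have "\<dots> = (\<Sum>m\<in>{m\<in>{?i..n}. v ?i < v m}. 1)"
    proof (rule sum.group)
      have "lam m \<in> {1..lam ?i}" if "m \<in> {?i..n}" for m
        using lam(1)[of ?i m] lam(2)[of m] that by auto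
      thus "lam ` {m\<in>{?i..n}. v ?i < v m} \<subseteq> {1..lam ?i}" by blast
    qed simp_all
    finally show ?thesis by simp
  qed
  have "rows_weight n N v ?i (S 0) B =
      (\<Sum>C\<in>column_states n N. rows_weight n N v k (S 0) C * row_weight n N (xv ?i) (Some (v ?i)) C B :: 'k ratfun)"
    by (simp add: rows_weight_def)
  also have "\<dots> = (\<Sum>C\<in>column_states n N. if C = S k then (\<Prod>i\<in>{1..k}. ?W i) *
      row_weight n N (xv ?i) (Some (v ?i)) (S k) B else 0)"
    using Suc.IH Suc.prems by (intro sum.cong refl) simp
  also have "\<dots> = (\<Prod>i\<in>{1..k}. ?W i) * row_weight n N (xv ?i) (Some (v ?i)) (S k) B"
    using S_state[of k] by (simp add: finite_PiE)
  also have "\<dots> = (if B = S ?i then \<Prod>i\<in>{1..?i}. ?W i else 0)"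
    unfolding row next_state exponent by (simp add: mult.commute)
  finally show ?case .
qed

lemma w0_w0 [simp]: "w0 n (w0 n i) = i"
  by (auto simp: w0_def)

lemma w0_permutes: "w0 n permutes {1..n}"
  unfolding permutes_def by (metis w0_w0 w0_def)

text \<open>
  The power of \<open>t\<close> in row \<open>i\<close> counts the larger colors leaving below it. Reversing the positions turns
  these pairs into the inversions of \<open>\<sigma>\<close>.
\<close>
lemma card_inversions_comp_w0:
  "(\<Sum>i\<in>{1..n}. card {m\<in>{i..n}. (\<sigma> \<circ> w0 n) i < (\<sigma> \<circ> w0 n) m}) = card (inversions n \<sigma>)"
proof -
  have "(\<Sum>i\<in>{1..n}. card {m\<in>{i..n}. (\<sigma> \<circ> w0 n) i < (\<sigma> \<circ> w0 n) m}) =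
      card (SIGMA i:{1..n}. {m\<in>{i..n}. (\<sigma> \<circ> w0 n) i < (\<sigma> \<circ> w0 n) m})"
    by (subst card_SigmaI) auto
  also have "\<dots> = card (inversions n \<sigma>)"
  proof (rule bij_betw_same_card)
    show "bij_betw (\<lambda>(a, b). (n + 1 - b, n + 1 - a))
        (SIGMA i:{1..n}. {m\<in>{i..n}. (\<sigma> \<circ> w0 n) i < (\<sigma> \<circ> w0 n) m}) (inversions n \<sigma>)"
    proof (rule bij_betw_byWitness[of _ "\<lambda>(a, b). (n + 1 - b, n + 1 - a)"])
      show "(\<lambda>(a, b). (n + 1 - b, n + 1 - a)) `
          (SIGMA i:{1..n}. {m\<in>{i..n}. (\<sigma> \<circ> w0 n) i < (\<sigma> \<circ> w0 n) m}) \<subseteq> inversions n \<sigma>"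
      proof clarify
        fix i m assume *: "i \<in> {1..n}" "m \<in> {i..n}" "(\<sigma> \<circ> w0 n) i < (\<sigma> \<circ> w0 n) m"
        hence "i \<noteq> m" by auto
        thus "(n + 1 - m, n + 1 - i) \<in> inversions n \<sigma>" using * by (auto simp: inversions_def w0_def)
      qed
    qed (auto simp: inversions_def w0_def)
  qed
  finally show ?thesis .
qed

text \<open>
  Exchanging two adjacent positions with equal parts stays in the coset, so by maximality \<open>\<sigma>\<close> has a
  descent there. Monotonicity of \<open>\<mu>\<close> makes positions with equal parts consecutive.
\<close>
lemma max_length_rep_descending:
  assumes \<sigma>: "\<sigma> permutes {1..n}" and max: "max_length_rep n \<mu> \<sigma>"
    and mono: "\<And>a b. 1 \<le> a \<Longrightarrow> a \<le> b \<Longrightarrow> b \<le> n \<Longrightarrow> \<mu> a \<le> \<mu> b"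
    and "1 \<le> a" "a < b" "b \<le> n" "\<mu> a = \<mu> b"
  shows "\<sigma> b < \<sigma> a"
proof -
  have adjacent: "\<sigma> (Suc i) < \<sigma> i" if i: "1 \<le> i" "i < n" "\<mu> i = \<mu> (Suc i)" for i
  proof (rule ccontr)
    assume "\<not> \<sigma> (Suc i) < \<sigma> i"
    moreover have "\<sigma> i \<noteq> \<sigma> (Suc i)" using permutes_inj[OF \<sigma>] by (simp add: inj_eq)
    ultimately have asc: "\<sigma> i < \<sigma> (Suc i)" by simp
    let ?s = "Transposition.transpose i (Suc i)"
    have s: "?s permutes {1..n}" using i by (intro permutes_swap_id) auto
    have "?s \<in> stab n \<mu>"
      using s i(3) by (auto simp: stab_def perm_act_def transpose_def)
    hence "\<sigma> \<circ> ?s \<in> left_coset n \<mu> \<sigma>" unfolding left_coset_def by (rule imageI)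
    hence "coxeter_length n (\<sigma> \<circ> ?s) \<le> coxeter_length n \<sigma>" using max by (simp only: max_length_rep_def)
    moreover have "\<sigma> \<circ> ?s permutes {1..n}" by (rule permutes_compose[OF s \<sigma>])
    ultimately show False
      using card_inversions_ascent[OF i(1,2) asc] coxeter_length_eq[OF \<sigma>] coxeter_length_eq[of "\<sigma> \<circ> ?s" n]
      by linarith
  qed
  have "\<sigma> c < \<sigma> a" if "Suc a \<le> c" "c \<le> n" "\<mu> a = \<mu> c" for c
    using that
  proof (induction c rule: dec_induct)
    case base
    thus ?case using adjacent[of a] \<open>1 \<le> a\<close> by simp
  next
    case (step c)
    have "\<mu> a \<le> \<mu> c" by (rule mono) (use step \<open>1 \<le> a\<close> in auto)
    moreover have "\<mu> c \<le> \<mu> (Suc c)" by (rule mono) (use step \<open>1 \<le> a\<close> in auto)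
    ultimately have "\<mu> a = \<mu> c" "\<mu> c = \<mu> (Suc c)" using step.prems by simp_all
    thus ?case using step adjacent[of c] \<open>1 \<le> a\<close> by simp
  qed
  thus ?thesis using assms by simp
qed

theorem theorem4p6:
  fixes n N :: nat
    and lam \<sigma> w :: "nat \<Rightarrow> nat"
  assumes "n \<le> N"
    and "\<forall>i\<in>{1..n}. \<forall>j\<in>{1..n}. i \<le> j \<longrightarrow> lam j \<le> lam i"
    and "\<forall>i\<in>{1..n}. 0 < lam i"
    and "\<forall>i\<in>{1..n}. lam i \<le> N"
    and "\<sigma> permutes {1..n}"
    and "w permutes {1..n}"
    and "max_length_rep n (perm_act (w0 n) lam) \<sigma>"
  shows "(partition_function n N lam \<sigma> w :: 'k::field ratfun) =
    tv ^ coxeter_length n \<sigma> *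
      inv (tau n w) (tau n (\<sigma> \<circ> w0 n) (\<Prod>i\<in>{1..n}. \<Prod>j\<in>{1..<lam i}. (1 - xv i / yv j)))"
proof -
  define v where "v = \<sigma> \<circ> w0 n"
  define start where "start = restrict (top_boundary n lam \<sigma>) {1..N}"
  define final where "final = (\<lambda>j\<in>{1..N}. {} :: nat set)"
  define P where "P = (\<Prod>i\<in>{1..n}. \<Prod>j\<in>{1..<lam i}. (1 - xv i / yv j) :: 'k ratfun)"
  let ?Z = "\<lambda>u. rows_weight n N u n start final :: 'k ratfun"
  let ?S = "\<lambda>k. \<lambda>j\<in>{1..N}. {v m | m. m \<in> {k<..n} \<and> lam m = j}"
  have v: "v permutes {1..n}" unfolding v_def by (rule permutes_compose[OF w0_permutes assms(5)])
  have start: "start \<in> column_states n N"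
    unfolding start_def by (rule top_boundary_in_column_states[OF assms(5)])
  have \<mu>: "perm_act (w0 n) lam k = lam (n + 1 - k)" if "k \<in> {1..n}" for k
  proof -
    have "inv (w0 n) = w0 n" by (rule inv_equality) simp_all
    thus ?thesis using that by (simp add: perm_act_def w0_def)
  qed
  have diagonal: "?Z v = tv ^ coxeter_length n \<sigma> * P"
  proof -
    have asc: "v i < v j" if "1 \<le> i" "i < j" "j \<le> n" "lam i = lam j" for i j
    proof -
      have "\<sigma> (n + 1 - i) < \<sigma> (n + 1 - j)"
      proof (rule max_length_rep_descending[OF assms(5,7)])
        fix a b assume "1 \<le> a" "a \<le> b" "b \<le> n"
        thus "perm_act (w0 n) lam a \<le> perm_act (w0 n) lam b"
          using assms(2)[rule_format, of "n + 1 - b" "n + 1 - a"] by (simp add: \<mu>)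
      next
        show "perm_act (w0 n) lam (n + 1 - j) = perm_act (w0 n) lam (n + 1 - i)"
        proof -
          have "n + 1 - i \<in> {1..n}" "n + 1 - j \<in> {1..n}" using that by auto
          thus ?thesis using that by (simp only: \<mu>) simp
        qed
      qed (use that in auto)
      thus ?thesis using that by (simp add: v_def w0_def)
    qed
    have s0: "start = ?S 0"
      unfolding start_def top_boundary_def
      by (intro ext) (auto simp: v_def w0_def restrict_def)
    have sn: "final = ?S n" by (auto simp: final_def)
    have fin: "final \<in> column_states n N" by (auto simp: final_def)
    have "?Z v = (if final = ?S n
        then \<Prod>i\<in>{1..n}. (\<Prod>j\<in>{1..<lam i}. 1 - xv i / yv j) * tv ^ card {m\<in>{i..n}. v i < v m} else 0)"
      unfolding s0
    proof (rule rows_weight_block_ascending[OF v])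
      show "lam j \<le> lam i" if "1 \<le> i" "i \<le> j" "j \<le> n" for i j using assms(2) that by simp
      show "lam i \<in> {1..N}" if "i \<in> {1..n}" for i
        using assms(3,4)[rule_format, OF that] by simp
    qed (fact asc le_refl fin)+
    also have "\<dots> = (\<Prod>i\<in>{1..n}. (\<Prod>j\<in>{1..<lam i}. 1 - xv i / yv j) * tv ^ card {m\<in>{i..n}. v i < v m})"
      by (rule if_P[OF sn])
    also have "\<dots> = P * tv ^ (\<Sum>i\<in>{1..n}. card {m\<in>{i..n}. v i < v m})"
      by (simp only: prod.distrib P_def power_sum)
    finally show ?thesis
      by (simp only: v_def card_inversions_comp_w0 coxeter_length_eq[OF assms(5)] mult.commute)
  qed
  let ?t = "tv ^ coxeter_length n \<sigma> :: 'k ratfun"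
  have lin: "tau n u (?t * f) = ?t * tau n u f" for u and f :: "'k ratfun"
    unfolding tau_def by (rule tau_word_tv)
  have inj: "inj (tau n w :: 'k ratfun \<Rightarrow> 'k ratfun)" unfolding tau_def by (rule inj_tau_word)
  have "?t * tau n w (?Z w / ?t) = tau n w (?Z w)"
    unfolding lin[symmetric] by simp
  also have "\<dots> = tau n v (?Z v)"
    by (simp only: tau_rows_weight[OF start assms(6)] tau_rows_weight[OF start v])
  also have "\<dots> = ?t * tau n v P" unfolding diagonal lin ..
  finally have "tau n w (?Z w / ?t) = tau n v P" by simp
  hence "inv (tau n w) (tau n v P) = ?Z w / ?t" using inv_f_f[OF inj] by metis
  hence "?Z w = ?t * inv (tau n w) (tau n v P)" by simp
  thus ?thesis
    unfolding partition_function_eq_rows_weight[OF assms(6,5)] start_def final_def P_def v_def .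
qed

end
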